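(* Let $\mathcal C$ be a class of square-lattice self-avoiding polygons, with $p_{m,n}$ the number of polygons in $\mathcal C$ of half-perimeter $m$ and area $n$, $p_m=\sum_n p_{m,n}$, $\mathcal P(x)=\sum_{m\ge0}p_mx^m$ and $p_m^{(k)}=\sum_n n^kp_{m,n}$. Assume that for every $k\in\mathbb N_0$, $p_m^{(k)}\sim A_k x_c^{-m}m^{\gamma_k-1}$ as $m\to\infty$, with $A_k>0$, $x_c>0$, $\gamma_k=(k-\theta)/\phi\in(-1,\infty)\setminus\{0\}$, $0<\phi<1$, and that the unpunctured model has the area amplitude series $F(z)=\sum_{k\ge0}f_kz^{-\gamma_k}$ with $f_k=\frac{(-1)^k}{k!}A_k x_c^{\gamma_k}\Gamma(\gamma_k)\neq0$. (i) Let $r\ge1$ and $s\in\mathbb N$ with $[x^s](\mathcal P(x))^r\ne0$. Then the model of punctured polygons of the class with $r$ punctures whose half-perimeters sum to $s$ has an area amplitude series $F^{(r,s)}(z)=\sum_{k\ge0}f_k^{(r)}z^{-\gamma_k^{(r)}}$ with $\gamma_k^{(r)}=(k-\theta_r)/\phi_r$, $\theta_r=\theta-r$, $\phi_r=\phi$, and $$F^{(r,s)}(z)=\frac{(-1)^r}{r!}\,x_c^s[x^s](\mathcal P(x))^r\sum_{k\ge r}(k)_r f_kz^{-\gamma_k}.$$ (ii) If $\theta>0$, the model of punctured polygons of the class with $r\ge1$ punctures of arbitrary size has area amplitude series $$F^{(r)}(z)=\frac{(-1)^r}{r!}(\mathcal P(x_c))^r\sum_{k\ge r}(k)_rf_kz^{-\gamma_k},$$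 where $\mathcal P(x_c)=\lim_{x\nearrow x_c}\mathcal P(x)<\infty$.
   Context: Polygons are considered up to translation; half-perimeter is half the number of edges, area is the number of enclosed unit cells. A punctured polygon with $r$ punctures consists of an outer polygon from $\mathcal C$ and an unordered collection of $r$ polygons from $\mathcal C$ inside it, all boundary curves pairwise disjoint; its half-perimeter is the sum of all half-perimeters and its area is the outer area minus the hole areas. $(a)_k=a(a-1)\cdots(a-k+1)$. For a model with half-perimeter and area generating function $Q(x,q)=\sum_{m,n}c_{m,n}x^mq^n$ (with $x_c$ the radius of convergence of $Q(x,1)$), its factorial moment generating functions are $g_k(x)=\frac{(-1)^k}{k!}\partial_q^kQ(x,q)|_{q=1}$; for a power series $g$ with radius of convergence $x_c$ set $g^{(c)}=\lim_{x\nearrow x_c}g(x)$ if this limit is finite and $g^{(c)}=0$ otherwise. The model has area amplitude series $\sum_{k\ge0}h_kz^{-\beta_k}$ (a formal series) if $g_k(x)-g_k^{(c)}\sim h_k(x_c-x)^{-\beta_k}$ as $x\nearrow x_c$ for all $k\in\mathbb N_0$. $[x^s]G$ denotes the coefficient of $x^s$ in $G$. *)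

theory Defs
  imports "HOL-Analysis.Analysis" "HOL-Library.Landau_Symbols"
begin

text \<open>A polygon is represented by its set of edges, and an edge by the set of its two end points.\<close>

type_synonym vertex = "int \<times> int"
type_synonym polygon = "vertex set set"

definition lattice_adj :: "vertex \<Rightarrow> vertex \<Rightarrow> bool" where
  "lattice_adj u v \<longleftrightarrow> \<bar>fst u - fst v\<bar> + \<bar>snd u - snd v\<bar> = 1"

definition cycle_edges :: "vertex list \<Rightarrow> polygon" where
  "cycle_edges vs = {{vs ! i, vs ! (Suc i mod length vs)} |i. i < length vs}"

text \<open>The length bound only excludes the degenerate back-and-forth step along one edge.\<close>

definition self_avoiding_polygon :: "polygon \<Rightarrow> bool" where
  "self_avoiding_polygon P \<longleftrightarrow>
     (\<exists>vs. length vs \<ge> 3 \<and> distinct vs \<and>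
           (\<forall>i < length vs. lattice_adj (vs ! i) (vs ! (Suc i mod length vs))) \<and>
           P = cycle_edges vs)"

definition point :: "vertex \<Rightarrow> real \<times> real" where
  "point v = (of_int (fst v), of_int (snd v))"

definition curve :: "polygon \<Rightarrow> (real \<times> real) set" where
  "curve P = (\<Union>e\<in>P. convex hull (point ` e))"

text \<open>A unit cell is named by its lower left corner.\<close>

definition cells :: "polygon \<Rightarrow> vertex set" where
  "cells P = {c. box (point c) (point (c + (1, 1))) \<subseteq> inside (curve P)}"

definition half_perimeter :: "polygon \<Rightarrow> nat" where
  "half_perimeter P = card P div 2"

definition area :: "polygon \<Rightarrow> nat" where
  "area P = card (cells P)"

definition translate :: "vertex \<Rightarrow> polygon \<Rightarrow> polygon" where
  "translate v P = (\<lambda>e. (+) v ` e) ` P"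

definition polygon_class :: "polygon set \<Rightarrow> bool" where
  "polygon_class C \<longleftrightarrow>
     (\<forall>P\<in>C. self_avoiding_polygon P) \<and> (\<forall>P\<in>C. \<forall>v. translate v P \<in> C)"

text \<open>
  The punctures are holes of the outer polygon, so they are not nested: no unit cell belongs to
  two of them.  The boundary curves being disjoint, two punctures in an unordered collection are
  never equal, so a collection of \<open>r\<close> punctures is a set with \<open>r\<close> elements.
\<close>

type_synonym punctured = "polygon \<times> polygon set"

definition punctured_polygons :: "polygon set \<Rightarrow> nat \<Rightarrow> punctured set" where
  "punctured_polygons C r =
     {(P, H). P \<in> C \<and> H \<subseteq> C \<and> finite H \<and> card H = r \<and>
        (\<forall>h\<in>H. curve h \<subseteq> inside (curve P) \<and> curve h \<inter> curve P = {}) \<and>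
        (\<forall>h\<in>H. \<forall>h'\<in>H. h \<noteq> h' \<longrightarrow> curve h \<inter> curve h' = {} \<and> cells h \<inter> cells h' = {})}"

definition punctured_polygons_sum :: "polygon set \<Rightarrow> nat \<Rightarrow> nat \<Rightarrow> punctured set" where
  "punctured_polygons_sum C r s =
     {(P, H) \<in> punctured_polygons C r. (\<Sum>h\<in>H. half_perimeter h) = s}"

definition punctured_half_perimeter :: "punctured \<Rightarrow> nat" where
  "punctured_half_perimeter = (\<lambda>(P, H). half_perimeter P + (\<Sum>h\<in>H. half_perimeter h))"

text \<open>
  The subtraction never truncates: the cells of the punctures are pairwise disjoint and are cells
  of the outer polygon.
\<close>

definition punctured_area :: "punctured \<Rightarrow> nat" where
  "punctured_area = (\<lambda>(P, H). area P - (\<Sum>h\<in>H. area h))"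

definition punctured_translate :: "vertex \<Rightarrow> punctured \<Rightarrow> punctured" where
  "punctured_translate v = (\<lambda>(P, H). (translate v P, translate v ` H))"

definition count_orbits :: "(vertex \<Rightarrow> 'a \<Rightarrow> 'a) \<Rightarrow> 'a set \<Rightarrow> nat" where
  "count_orbits act X = card (X // {(x, y). \<exists>v. y = act v x})"

text \<open>
  Series in the half-perimeter variable whose coefficients are polynomials in the area variable
  \<open>q\<close>: up to translation, only finitely many objects have a given half-perimeter.
\<close>

definition generating_function :: "(nat \<Rightarrow> nat \<Rightarrow> nat) \<Rightarrow> real poly fps" where
  "generating_function c = Abs_fps (\<lambda>m. \<Sum>n | c m n \<noteq> 0. monom (real (c m n)) n)"

definition num_polygons :: "polygon set \<Rightarrow> nat \<Rightarrow> nat \<Rightarrow> nat" where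
  "num_polygons C m n =
     count_orbits translate {P \<in> C. half_perimeter P = m \<and> area P = n}"

definition num_punctured :: "punctured set \<Rightarrow> nat \<Rightarrow> nat \<Rightarrow> nat" where
  "num_punctured X m n =
     count_orbits punctured_translate
       {S \<in> X. punctured_half_perimeter S = m \<and> punctured_area S = n}"

text \<open>The sums over all areas have finitely many nonzero terms.\<close>

definition area_moment :: "polygon set \<Rightarrow> nat \<Rightarrow> nat \<Rightarrow> real" where
  "area_moment C k m = (\<Sum>n. real n ^ k * real (num_polygons C m n))"

definition perimeter_gf :: "polygon set \<Rightarrow> real fps" where
  "perimeter_gf C = Abs_fps (\<lambda>m. \<Sum>n. real (num_polygons C m n))"

definition eval_q1 :: "real poly fps \<Rightarrow> real fps" where
  "eval_q1 Q = Abs_fps (\<lambda>m. poly (fps_nth Q m) 1)"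

definition q_deriv :: "real poly fps \<Rightarrow> real poly fps" where
  "q_deriv Q = Abs_fps (\<lambda>m. pderiv (fps_nth Q m))"

definition factorial_moment_gf :: "real poly fps \<Rightarrow> nat \<Rightarrow> real fps" where
  "factorial_moment_gf Q k = fps_const ((-1) ^ k / fact k) * eval_q1 ((q_deriv ^^ k) Q)"

definition critical_value :: "real fps \<Rightarrow> real \<Rightarrow> real" where
  "critical_value g xc =
     (if \<exists>L. (eval_fps g \<longlongrightarrow> L) (at_left xc) then Lim (at_left xc) (eval_fps g) else 0)"

text \<open>The critical value is only meaningful for series whose radius of convergence is \<open>xc\<close>.\<close>

definition has_area_amplitude_series ::
    "real poly fps \<Rightarrow> (nat \<Rightarrow> real) \<Rightarrow> (nat \<Rightarrow> real) \<Rightarrow> bool" where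
  "has_area_amplitude_series Q h \<beta> \<longleftrightarrow>
     (\<exists>xc > 0. fps_conv_radius (eval_q1 Q) = ereal xc \<and>
        (\<forall>k. fps_conv_radius (factorial_moment_gf Q k) = ereal xc \<and>
             (\<lambda>x. eval_fps (factorial_moment_gf Q k) x -
                    critical_value (factorial_moment_gf Q k) xc)
               \<sim>[at_left xc] (\<lambda>x. h k * (xc - x) powr (- \<beta> k))))"

text \<open>
  The formal series with terms \<open>h k * z powr (- \<beta> k)\<close>, for \<open>k\<close> in \<open>K\<close>, is represented by the
  function that maps \<open>b\<close> to the coefficient of \<open>z powr (- b)\<close>; each value \<open>b\<close> has to be attained
  by \<open>\<beta>\<close> only finitely often.
\<close>

definition formal_series ::
    "nat set \<Rightarrow> (nat \<Rightarrow> real) \<Rightarrow> (nat \<Rightarrow> real) \<Rightarrow> real \<Rightarrow> real" where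
  "formal_series K h \<beta> = (\<lambda>b. \<Sum>k | k \<in> K \<and> \<beta> k = b. h k)"

definition falling_factorial :: "real \<Rightarrow> nat \<Rightarrow> real" where
  "falling_factorial a r = (\<Prod>i<r. a - real i)"

end

theory Submission
  imports Defs "HOL-Combinatorics.Multiset_Permutations" "HOL-Real_Asymp.Real_Asymp"
begin

text \<open>
  Factorial moments of the area are the coefficients of the moment generating functions.  In an
  outer polygon of area \<open>N\<close> and half-perimeter \<open>m\<close>, the ordered placements of \<open>r\<close> given holes number
  at most \<open>N ^ r\<close> and at least \<open>(N - K * (m + 1)) ^ r\<close>, since only cells near the boundary or near
  another hole are lost, and the holes change the area by a bounded amount.  Because \<open>\<phi> < 1\<close>, a
  factor \<open>m\<close> is negligible against a factor \<open>N\<close> in the moments.  So the \<open>k\<close>-th moment of the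
  punctured model is \<open>[x ^ s] P ^ r / r!\<close> times the \<open>(k + r)\<close>-th moment of the unpunctured one, shifted
  by \<open>s\<close>.  As \<open>\<gamma> (k + r) > 0\<close>, all series involved diverge at \<open>xc\<close>, and the ratio of coefficients
  carries over to the generating functions; no Tauberian or Abelian theorem with Gamma factors is
  needed, because the singular behaviour of the unpunctured series is a hypothesis.
\<close>

text \<open>The bound \<open>\<gamma> k > -1\<close> at k = 0 gives \<theta> < \<phi> < 1, hence
  \<open>\<gamma> j > 0\<close> for all j \<ge> 1. With r \<ge> 1 punctures only indices k + r \<ge>
  1 are met, so the sign of \<open>\<gamma> 0\<close> enters only through the finiteness of P(xc).
  Consecutive exponents differ by 1/\<phi> > 1, which is what absorbs a loss of K * (m + 1) cells.

  The obstacle for punctures of arbitrary size is that K grows with their total half-perimeter s.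
  The upper bound carries no such constant and may be summed over all s, which yields a product of
  series; the lower bound is not uniform in s and is summed over finitely many s only. The two meet
  because P(x)^r tends to a finite limit at xc, so the tail of large punctures contributes
  arbitrarily little.

  The topology rests on two facts: a connected set that misses a curve and meets its inside lies in
  the inside, and a convex set has empty inside.\<close>

subsection \<open>Geometry of lattice polygons\<close>

lemma self_avoiding_polygonE:
  assumes "self_avoiding_polygon P"
  obtains vs where "length vs \<ge> 3" "\<And>i. i < length vs \<Longrightarrow> lattice_adj (vs ! i) (vs ! (Suc i mod length vs))"
    "P = cycle_edges vs" "\<Union>P = set vs" "finite P" "distinct vs"
proof -
  obtain vs where vs: "length vs \<ge> 3" "distinct vs"
      "\<forall>i < length vs. lattice_adj (vs ! i) (vs ! (Suc i mod length vs))" "P = cycle_edges vs"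
    using assms unfolding self_avoiding_polygon_def by blast
  have P: "P = (\<lambda>i. {vs ! i, vs ! (Suc i mod length vs)}) ` {..<length vs}"
    using vs(4) by (auto simp: cycle_edges_def)
  have "length vs > 0" using vs(1) by linarith
  then have "vs ! (Suc i mod length vs) \<in> set vs" for i by simp
  then have "\<Union>P \<subseteq> set vs" using P by auto
  moreover have "set vs \<subseteq> \<Union>P" unfolding P by (auto simp: in_set_conv_nth) (metis lessThan_iff)
  ultimately have "\<Union>P = set vs" by blast
  moreover have "finite P" using P by simp
  ultimately show ?thesis using vs that[of vs] by blast
qed

lemma polygon_edgeE:
  assumes "self_avoiding_polygon P" "e \<in> P"
  obtains u w where "e = {u, w}" "lattice_adj u w"
proof -
  obtain vs where "\<And>i. i < length vs \<Longrightarrow> lattice_adj (vs ! i) (vs ! (Suc i mod length vs))"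
    "P = cycle_edges vs" using self_avoiding_polygonE[OF assms(1)] by metis
  then show ?thesis using assms(2) that unfolding cycle_edges_def by blast
qed

lemma polygon_vertices:
  assumes "self_avoiding_polygon P"
  shows "finite (\<Union>P)" "\<Union>P \<noteq> {}" "finite P" "card (\<Union>P) \<le> 4 * half_perimeter P + 2"
proof -
  obtain vs where vs: "length vs \<ge> 3" "P = cycle_edges vs" "\<Union>P = set vs" "finite P"
    using self_avoiding_polygonE[OF assms] by metis
  show "finite (\<Union>P)" "\<Union>P \<noteq> {}" "finite P" using vs by auto
  have "card (\<Union>P) \<le> (\<Sum>e\<in>P. card e)"
    by (rule card_Union_le_sum_card)
  also have "\<dots> \<le> (\<Sum>e\<in>P. 2)"
  proof (rule sum_mono)
    fix e assume "e \<in> P"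
    then obtain u w where "e = {u, w}" using polygon_edgeE[OF assms] by metis
    then show "card e \<le> 2" by (simp add: card_insert_if)
  qed
  \<comment> \<open>\<open>half_perimeter\<close> rounds down, so \<open>card P\<close> is at most 2
    * \<open>half_perimeter P\<close> + 1; two end points per edge double this.\<close>
  also have "\<dots> \<le> 4 * half_perimeter P + 2" unfolding half_perimeter_def by simp
  finally show "card (\<Union>P) \<le> 4 * half_perimeter P + 2" .
qed

text \<open>The lattice ball of radius d in the maximum norm; \<open>big_square\<close> is its
  counterpart in the plane. All nearness conditions are phrased with these balls, as they are convex
  and easy to count.\<close>

definition square :: "vertex \<Rightarrow> nat \<Rightarrow> vertex set" where
  "square v d = {fst v - int d..fst v + int d} \<times> {snd v - int d..snd v + int d}"

lemma finite_square: "finite (square v d)"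
  by (simp add: square_def)

lemma card_square: "card (square v d) = (2 * d + 1)\<^sup>2"
proof -
  have "nat (1 + int d * 2) = 2 * d + 1" by linarith
  then show ?thesis by (simp add: square_def card_cartesian_product power2_eq_square algebra_simps)
qed

lemma square_mono: "d \<le> d' \<Longrightarrow> square v d \<subseteq> square v d'"
  by (auto simp: square_def)

lemma square_sym: "u \<in> square v d \<longleftrightarrow> v \<in> square u d"
  by (cases u; cases v) (auto simp: square_def)

text \<open>Walking along the vertex list moves by one unit per step, so every vertex is within 4 *
  \<open>half_perimeter P\<close> + 2 of the first one. The triangle inequality doubles this
  radius.\<close>

lemma polygon_diameter:
  assumes "self_avoiding_polygon P" "u \<in> \<Union>P" "v \<in> \<Union>P"
  shows "u \<in> square v (8 * half_perimeter P + 4)"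
proof -
  obtain vs where vs: "length vs \<ge> 3" "\<Union>P = set vs" "distinct vs"
    "\<And>i. i < length vs \<Longrightarrow> lattice_adj (vs ! i) (vs ! (Suc i mod length vs))"
    using self_avoiding_polygonE[OF assms(1)] by metis
  have near: "vs ! i \<in> square (vs ! 0) i" if "i < length vs" for i
    using that
  proof (induction i)
    case 0
    then show ?case by (cases "vs ! 0") (auto simp: square_def)
  next
    case (Suc i)
    then have "lattice_adj (vs ! i) (vs ! Suc i)" using vs(4)[of i] by simp
    then show ?case using Suc
      by (cases "vs ! 0"; cases "vs ! i"; cases "vs ! Suc i")
        (auto simp: square_def lattice_adj_def)
  qed
  have len: "length vs \<le> 4 * half_perimeter P + 2"
    using polygon_vertices(4)[OF assms(1)] vs(2,3) by (simp add: distinct_card)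
  have *: "w \<in> square (vs ! 0) (4 * half_perimeter P + 2)" if "w \<in> \<Union>P" for w
  proof -
    obtain i where "i < length vs" "w = vs ! i" using \<open>w \<in> \<Union>P\<close> vs(2) by (auto simp: in_set_conv_nth)
    then show ?thesis using near[of i] square_mono[of i "4 * half_perimeter P + 2" "vs ! 0"] len by auto
  qed
  show ?thesis using *[OF assms(2)] *[OF assms(3)]
    by (cases u; cases v; cases "vs ! 0") (auto simp: square_def)
qed

section \<open>Curves, unit cells and the inside\<close>

lemma point_add: "point (u + v) = point u + point v"
  by (simp add: point_def)

lemma mem_cell_iff:
  "z \<in> box (point c) (point (c + (1, 1))) \<longleftrightarrow>
     of_int (fst c) < fst z \<and> fst z < of_int (fst c) + 1 \<and>
     of_int (snd c) < snd z \<and> snd z < of_int (snd c) + 1"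
  by (cases z) (auto simp: point_def box_def Basis_prod_def)

lemma cell_midpoint:
  "(of_int (fst c) + 1/2, of_int (snd c) + 1/2) \<in> box (point c) (point (c + (1, 1)))"
  by (simp add: mem_cell_iff)

definition big_square :: "vertex \<Rightarrow> nat \<Rightarrow> (real \<times> real) set" where
  "big_square v d = {of_int (fst v) - real d..of_int (fst v) + real d} \<times>
                    {of_int (snd v) - real d..of_int (snd v) + real d}"

lemma convex_big_square: "convex (big_square v d)"
  unfolding big_square_def by (intro convex_Times convex_real_interval)

lemma mem_closed_segment_adj:
  assumes "lattice_adj u w" "z \<in> closed_segment (point u) (point w)"
  shows "fst z = of_int (fst u) \<or> snd z = of_int (snd u)"
    "\<bar>fst z - of_int (fst u)\<bar> \<le> 1" "\<bar>snd z - of_int (snd u)\<bar> \<le> 1"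
proof -
  obtain t where t: "0 \<le> t" "t \<le> 1" "z = (1 - t) *\<^sub>R point u + t *\<^sub>R point w"
    using assms(2) by (auto simp: closed_segment_def)
  have z: "fst z = of_int (fst u) + t * of_int (fst w - fst u)"
    "snd z = of_int (snd u) + t * of_int (snd w - snd u)"
    using t(3) by (simp_all add: point_def algebra_simps)
  have "fst w - fst u = 0 \<and> \<bar>snd w - snd u\<bar> = 1 \<or> \<bar>fst w - fst u\<bar> = 1 \<and> snd w - snd u = 0"
    using assms(1) unfolding lattice_adj_def by linarith
  then consider "fst w - fst u = 0" "\<bar>snd w - snd u\<bar> = 1" | "\<bar>fst w - fst u\<bar> = 1" "snd w - snd u = 0" by blast
  note c = this
  have a: "t * \<bar>real_of_int k - real_of_int l\<bar> \<le> 1" if "\<bar>k - l\<bar> = 1" for k l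
  proof -
    have "\<bar>real_of_int k - real_of_int l\<bar> = 1" using that by linarith
    then show ?thesis using t by simp
  qed
  show "fst z = of_int (fst u) \<or> snd z = of_int (snd u)"
    using c by cases (use z in auto)
  show "\<bar>fst z - of_int (fst u)\<bar> \<le> 1"
    using c by cases (use z t a in \<open>auto simp: abs_mult\<close>)
  show "\<bar>snd z - of_int (snd u)\<bar> \<le> 1"
    using c by cases (use z t a in \<open>auto simp: abs_mult\<close>)
qed

lemma curveE:
  assumes "self_avoiding_polygon P" "z \<in> curve P"
  obtains u w where "u \<in> \<Union>P" "lattice_adj u w" "z \<in> closed_segment (point u) (point w)"
proof -
  obtain e where e: "e \<in> P" "z \<in> convex hull (point ` e)" using assms(2) by (auto simp: curve_def)
  obtain u w where "e = {u, w}" "lattice_adj u w" using polygon_edgeE[OF assms(1) e(1)] by metis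
  then show ?thesis using e that[of u w] by (auto simp: segment_convex_hull)
qed

lemma vertex_in_curve: "v \<in> \<Union>P \<Longrightarrow> point v \<in> curve P"
  by (auto simp: curve_def intro: hull_inc)

text \<open>A lattice edge is parallel to an axis, so every point of the curve has an integer
  coordinate, whereas both coordinates of a point of an open cell lie strictly between consecutive
  integers.\<close>

lemma cell_disjoint_curve:
  assumes "self_avoiding_polygon P"
  shows "box (point c) (point (c + (1, 1))) \<inter> curve P = {}"
proof -
  have False if z: "z \<in> box (point c) (point (c + (1, 1)))" "z \<in> curve P" for z
  proof -
    obtain u w where "lattice_adj u w" "z \<in> closed_segment (point u) (point w)"
      using curveE[OF assms z(2)] by metis
    then have "fst z = of_int (fst u) \<or> snd z = of_int (snd u)" by (rule mem_closed_segment_adj)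
    moreover have False if "real_of_int a < of_int b" "real_of_int b < of_int a + 1" for a b
    proof -
      have "a < b" "b < a + 1" using that by linarith+
      then show False by simp
    qed
    ultimately show False using z(1) unfolding mem_cell_iff by metis
  qed
  then show ?thesis by blast
qed

text \<open>The inside is a union of connected components of the complement, and a connected subset
  of the complement stays in one component.\<close>

lemma connected_subset_inside:
  assumes "connected T" "T \<inter> S = {}" "T \<inter> inside S \<noteq> {}"
  shows "T \<subseteq> inside S"
proof
  fix y assume "y \<in> T"
  obtain x where x: "x \<in> T" "x \<in> inside S" using assms(3) by blast
  have "connected_component (- S) x y"
    unfolding connected_component_def using assms x \<open>y \<in> T\<close> by (intro exI[of _ T]) auto
  then show "y \<in> inside S" using x inside_same_component by metis
qed

text \<open>Adding the corner to its open cell keeps it connected, since the corner lies in the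
  closure of the cell. Thus the anchors of holes may be counted as cells of the outer polygon, which
  yields the bound N^r on their positions.\<close>

lemma inside_vertex_in_cells:
  assumes "self_avoiding_polygon P" "point v \<in> inside (curve P)"
  shows "v \<in> cells P"
proof -
  let ?B = "box (point v) (point (v + (1, 1)))"
  have ne: "?B \<noteq> {}" using cell_midpoint[of v] by blast
  have "connected (insert (point v) ?B)"
  proof (rule connected_intermediate_closure)
    show "connected ?B" by (intro convex_connected convex_box)
    have "point v \<in> cbox (point v) (point (v + (1, 1)))"
      by (cases v) (simp add: point_def mem_box Basis_prod_def)
    then show "insert (point v) ?B \<subseteq> closure ?B"
      using closure_box[OF ne] closure_subset[of ?B] by auto
  qed auto
  moreover have "insert (point v) ?B \<inter> curve P = {}"
    using cell_disjoint_curve[OF assms(1), of v] assms(2) inside_no_overlap by blast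
  ultimately have "insert (point v) ?B \<subseteq> inside (curve P)"
    using assms(2) by (intro connected_subset_inside) auto
  then show ?thesis by (simp add: cells_def)
qed

lemma curve_subset_big_square:
  assumes "self_avoiding_polygon P" "\<Union>P \<subseteq> square v d"
  shows "curve P \<subseteq> big_square v (Suc d)"
proof
  fix z assume "z \<in> curve P"
  then obtain u w where u: "u \<in> \<Union>P" "lattice_adj u w" "z \<in> closed_segment (point u) (point w)"
    using curveE[OF assms(1)] by metis
  have "u \<in> square v d" using u(1) assms(2) by blast
  then have "\<bar>real_of_int (fst u) - of_int (fst v)\<bar> \<le> real d" "\<bar>real_of_int (snd u) - of_int (snd v)\<bar> \<le> real d"
    by (cases u; cases v; auto simp: square_def abs_le_iff; linarith)+
  \<comment> \<open>The radius grows by one because z is only known to be within one unit of the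
    vertex u.\<close>
  then show "z \<in> big_square v (Suc d)"
    using mem_closed_segment_adj(2,3)[OF u(2,3)] by (cases z) (auto simp: big_square_def abs_le_iff)
qed

text \<open>The inside of a subset of T lies in T together with the inside of T, and the convex
  square has no inside.\<close>

lemma inside_subset_big_square:
  assumes "self_avoiding_polygon P" "\<Union>P \<subseteq> square v d"
  shows "inside (curve P) \<subseteq> big_square v (Suc d)"
proof -
  have "inside (big_square v (Suc d)) = {}"
    by (rule inside_convex[OF convex_big_square])
  then show ?thesis
    using inside_mono[OF curve_subset_big_square[OF assms]] by blast
qed

lemma cells_subset_square:
  assumes "self_avoiding_polygon P" "\<Union>P \<subseteq> square v d"
  shows "cells P \<subseteq> square v (Suc d)"
proof
  fix c assume "c \<in> cells P"
  then have "(of_int (fst c) + 1/2, of_int (snd c) + 1/2) \<in> inside (curve P)"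
    using cell_midpoint[of c] by (auto simp: cells_def)
  then have "(of_int (fst c) + 1/2, of_int (snd c) + 1/2) \<in> big_square v (Suc d)"
    using inside_subset_big_square[OF assms] by blast
  then show "c \<in> square v (Suc d)"
    by (cases c; cases v; auto simp: big_square_def square_def; linarith)
qed

lemma polygon_subset_square:
  assumes "self_avoiding_polygon P" "v \<in> \<Union>P"
  shows "\<Union>P \<subseteq> square v (8 * half_perimeter P + 4)"
  using polygon_diameter[OF assms(1) _ assms(2)] by blast

lemma finite_cells:
  assumes "self_avoiding_polygon P"
  shows "finite (cells P)"
proof -
  obtain v where "v \<in> \<Union>P" using polygon_vertices(2)[OF assms] by blast
  then show ?thesis
    using cells_subset_square[OF assms polygon_subset_square[OF assms]] finite_square finite_subset by metis
qed

lemma area_le: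
  assumes "self_avoiding_polygon P"
  shows "area P \<le> (2 * (8 * half_perimeter P + 5) + 1)\<^sup>2"
proof -
  obtain v where v: "v \<in> \<Union>P" using polygon_vertices(2)[OF assms] by blast
  have "card (cells P) \<le> card (square v (Suc (8 * half_perimeter P + 4)))"
    by (intro card_mono finite_square cells_subset_square[OF assms polygon_subset_square[OF assms v]])
  then show ?thesis by (simp add: area_def card_square)
qed

text \<open>Each point of the curve is within one unit of a vertex, so clearing the vertices from
  radius d + 1 clears the curve from radius d. The midpoint of the cell c then anchors the connected
  square in the inside; d \<ge> 1 puts this midpoint into the square.\<close>

lemma big_square_subset_inside:
  assumes "self_avoiding_polygon P" "c \<in> cells P" "square c (Suc d) \<inter> \<Union>P = {}" "d \<ge> 1"
  shows "big_square c d \<subseteq> inside (curve P)"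
proof (rule connected_subset_inside)
  show "connected (big_square c d)" by (rule convex_connected[OF convex_big_square])
  have "z \<notin> big_square c d" if z: "z \<in> curve P" for z
  proof
    assume "z \<in> big_square c d"
    obtain u w where u: "u \<in> \<Union>P" "lattice_adj u w" "z \<in> closed_segment (point u) (point w)"
      using curveE[OF assms(1) z] by metis
    have "u \<in> square c (Suc d)"
      using mem_closed_segment_adj(2,3)[OF u(2,3)] \<open>z \<in> big_square c d\<close>
      by (cases u; cases c; cases z; auto simp: square_def big_square_def abs_le_iff; linarith)
    then show False using u(1) assms(3) by blast
  qed
  then show "big_square c d \<inter> curve P = {}" by blast
  have "(of_int (fst c) + 1/2, of_int (snd c) + 1/2) \<in> big_square c d"
    using assms(4) by (auto simp: big_square_def)
  moreover have "(of_int (fst c) + 1/2, of_int (snd c) + 1/2) \<in> inside (curve P)"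
    using cell_midpoint[of c] assms(2) unfolding cells_def by blast
  ultimately show "big_square c d \<inter> inside (curve P) \<noteq> {}" by blast
qed

lemma big_square_disjoint:
  assumes "u \<notin> square v (2 * d)"
  shows "big_square u d \<inter> big_square v d = {}"
proof -
  have False if "z \<in> big_square u d" "z \<in> big_square v d" for z
  proof -
    have "\<bar>real_of_int (fst u) - of_int (fst v)\<bar> \<le> 2 * real d" "\<bar>real_of_int (snd u) - of_int (snd v)\<bar> \<le> 2 * real d"
      using that by (auto simp: big_square_def abs_le_iff)
    then have "\<bar>fst u - fst v\<bar> \<le> 2 * int d" "\<bar>snd u - snd v\<bar> \<le> 2 * int d" by linarith+
    then show False using assms by (cases u; cases v) (auto simp: square_def abs_le_iff)
  qed
  then show ?thesis by blast
qed

subsection \<open>Polygons up to translation\<close>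

lemma translate_0 [simp]: "translate 0 P = P"
  by (simp add: translate_def)

lemma translate_translate [simp]: "translate u (translate v P) = translate (u + v) P"
  by (simp add: translate_def image_image add.assoc)

lemma Union_translate: "\<Union>(translate v P) = (+) v ` \<Union>P"
  by (auto simp: translate_def)

lemma inj_translate: "inj (translate v)"
  by (rule inj_on_inverseI[of _ "translate (- v)"]) simp

lemma half_perimeter_translate [simp]: "half_perimeter (translate v P) = half_perimeter P"
proof -
  have "inj_on (\<lambda>e. (+) v ` e) P" by (auto simp: inj_on_def inj_image_eq_iff)
  then show ?thesis by (simp add: half_perimeter_def translate_def card_image)
qed

lemma curve_translate: "curve (translate v P) = (+) (point v) ` curve P"
proof -
  have "convex hull (point ` (+) v ` e) = (+) (point v) ` (convex hull (point ` e))" for e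
  proof -
    have "point ` (+) v ` e = (\<lambda>x. point v + x) ` point ` e" by (simp add: image_image point_add)
    then show ?thesis by (simp only: convex_hull_translation)
  qed
  then show ?thesis by (auto simp: curve_def translate_def)
qed

text \<open>One inclusion is shown for all translations and all sets; the converse is the same
  inclusion applied to the translated set and \<open>- a\<close>.\<close>

lemma inside_translation:
  fixes S :: "'a::real_normed_vector set"
  shows "inside ((+) a ` S) = (+) a ` inside S"
proof -
  have *: "a + x \<in> inside ((+) a ` S)" if x: "x \<in> inside S" for a x :: 'a and S
  proof -
    have "connected_component_set (- ((+) a ` S)) (a + x) \<subseteq> (+) a ` connected_component_set (- S) x"
    proof
      fix y assume "y \<in> connected_component_set (- ((+) a ` S)) (a + x)"
      then obtain T where T: "connected T" "T \<subseteq> - ((+) a ` S)" "a + x \<in> T" "y \<in> T"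
        by (auto simp: connected_component_def)
      have "connected ((+) (- a) ` T)"
        by (intro connected_continuous_image continuous_intros T(1))
      moreover have "(+) (- a) ` T \<subseteq> - S" using T(2) by force
      moreover have "x \<in> (+) (- a) ` T" "y - a \<in> (+) (- a) ` T" using T(3,4) by force+
      ultimately have "connected_component (- S) x (y - a)"
        unfolding connected_component_def by blast
      then show "y \<in> (+) a ` connected_component_set (- S) x"
        by (intro image_eqI[of _ _ "y - a"]) auto
    qed
    moreover have "bounded ((+) a ` connected_component_set (- S) x)"
      using x by (intro bounded_translation) (simp add: inside_def)
    ultimately show ?thesis using x bounded_subset by (auto simp: inside_def)
  qed
  have "x \<in> (+) a ` inside S" if "x \<in> inside ((+) a ` S)" for x
    using *[OF that, of "- a"] by (intro image_eqI[of _ _ "x - a"]) (auto simp: image_image)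
  then show ?thesis using * by blast
qed

lemma cells_translate: "cells (translate v P) = (+) v ` cells P"
proof -
  have box: "box (point (v + c)) (point (v + c + (1, 1))) = (+) (point v) ` box (point c) (point (c + (1, 1)))" for c
  proof (intro equalityI subsetI)
    fix z assume "z \<in> box (point (v + c)) (point (v + c + (1, 1)))"
    then show "z \<in> (+) (point v) ` box (point c) (point (c + (1, 1)))"
      unfolding mem_cell_iff by (intro image_eqI[of _ _ "z - point v"]; simp only: mem_cell_iff) (auto simp: point_def)
  next
    fix z assume "z \<in> (+) (point v) ` box (point c) (point (c + (1, 1)))"
    then show "z \<in> box (point (v + c)) (point (v + c + (1, 1)))"
      by (elim imageE; simp only: mem_cell_iff) (simp add: point_def)
  qed
  have iff: "v + c \<in> cells (translate v P) \<longleftrightarrow> c \<in> cells P" for c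
    unfolding cells_def curve_translate inside_translation mem_Collect_eq box
    by (rule inj_image_subset_iff) (simp add: inj_on_def)
  show ?thesis
  proof (intro equalityI subsetI)
    fix c assume "c \<in> cells (translate v P)"
    then show "c \<in> (+) v ` cells P"
      using iff[of "c - v"] by (intro image_eqI[of _ _ "c - v"]) auto
  next
    fix c assume "c \<in> (+) v ` cells P"
    then obtain c' where "c = v + c'" "c' \<in> cells P" by blast
    then show "c \<in> cells (translate v P)" using iff[of c'] by blast
  qed
qed

lemma area_translate [simp]: "area (translate v P) = area P"
  by (simp add: area_def cells_translate card_image)

text \<open>The lexicographically least vertex. This choice commutes with translations, so each
  translation class has exactly one member anchored at the origin.\<close>

definition anchor :: "polygon \<Rightarrow> vertex" where
  "anchor P = (let x = Min (fst ` \<Union>P) in (x, Min {y. (x, y) \<in> \<Union>P}))"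

lemma finite_column: "finite (V :: vertex set) \<Longrightarrow> finite {y. (x, y) \<in> V}"
  by (rule finite_subset[of _ "snd ` V"]) force+

lemma anchor_in:
  assumes "self_avoiding_polygon P"
  shows "anchor P \<in> \<Union>P"
proof -
  let ?x = "Min (fst ` \<Union>P)"
  note V = polygon_vertices(1,2)[OF assms]
  have "?x \<in> fst ` \<Union>P" using V by (intro Min_in) auto
  then have "{y. (?x, y) \<in> \<Union>P} \<noteq> {}" by force
  then have "Min {y. (?x, y) \<in> \<Union>P} \<in> {y. (?x, y) \<in> \<Union>P}"
    by (intro Min_in finite_column V)
  then show ?thesis by (simp add: anchor_def)
qed

lemma anchor_translate:
  assumes "self_avoiding_polygon P"
  shows "anchor (translate v P) = v + anchor P"
proof -
  let ?x = "Min (fst ` \<Union>P)"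
  note V = polygon_vertices(1,2)[OF assms]
  have m: "mono ((+) a)" for a :: int by (auto simp: mono_def)
  have "fst ` \<Union>(translate v P) = (+) (fst v) ` fst ` \<Union>P"
    unfolding Union_translate by (simp add: image_image)
  then have 1: "Min (fst ` \<Union>(translate v P)) = fst v + ?x"
    using mono_Min_commute[OF m, of "fst ` \<Union>P" "fst v"] V by simp
  have iff: "(fst v + a, b) \<in> (+) v ` U \<longleftrightarrow> (a, b - snd v) \<in> U" for a b and U :: "vertex set"
    by (cases v) force
  have "{y. (fst v + ?x, y) \<in> \<Union>(translate v P)} = (+) (snd v) ` {y. (?x, y) \<in> \<Union>P}"
    unfolding Union_translate iff
  proof (intro equalityI subsetI)
    fix y assume "y \<in> {y. (?x, y - snd v) \<in> \<Union>P}"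
    then show "y \<in> (+) (snd v) ` {y. (?x, y) \<in> \<Union>P}" by (intro image_eqI[of _ _ "y - snd v"]) auto
  qed auto
  moreover have "?x \<in> fst ` \<Union>P" using V by (intro Min_in) auto
  then have "{y. (?x, y) \<in> \<Union>P} \<noteq> {}" by force
  ultimately have "Min {y. (fst v + ?x, y) \<in> \<Union>(translate v P)} = snd v + Min {y. (?x, y) \<in> \<Union>P}"
    using mono_Min_commute[OF m finite_column[OF V(1)], of ?x "snd v"] by simp
  then show ?thesis by (simp add: anchor_def Let_def 1 prod_eq_iff)
qed

text \<open>An equivariant map into the translation group forces trivial stabilizers, and each orbit
  meets the fibre over 0 exactly once. The type is left general so that polygons and punctured
  polygons are treated alike.\<close>

lemma count_orbits_eq_card_anchored:
  fixes act :: "vertex \<Rightarrow> 'a \<Rightarrow> 'a" and anc :: "'a \<Rightarrow> vertex"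
  assumes act_0: "\<And>x. x \<in> X \<Longrightarrow> act 0 x = x"
    and act_act: "\<And>u v x. x \<in> X \<Longrightarrow> act u (act v x) = act (u + v) x"
    and closed: "\<And>v x. x \<in> X \<Longrightarrow> act v x \<in> X"
    and anc: "\<And>v x. x \<in> X \<Longrightarrow> anc (act v x) = v + anc x"
  shows "count_orbits act X = card {x \<in> X. anc x = 0}"
proof -
  define R where "R = {(x, y). \<exists>v. y = act v x}"
  have R: "R `` {x} = range (\<lambda>v. act v x)" for x by (auto simp: R_def)
  have "bij_betw (\<lambda>x. R `` {x}) {x \<in> X. anc x = 0} (X // R)"
  proof (rule bij_betw_imageI)
    show "inj_on (\<lambda>x. R `` {x}) {x \<in> X. anc x = 0}"
    proof (rule inj_onI)
      fix x y assume x: "x \<in> {x \<in> X. anc x = 0}" and y: "y \<in> {x \<in> X. anc x = 0}"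
        and eq: "R `` {x} = R `` {y}"
      have "act 0 x \<in> range (\<lambda>v. act v y)" using eq unfolding R by blast
      then obtain v where v: "x = act v y" using x act_0 by auto
      then have "v = 0" using anc[of y v] x y by simp
      then show "x = y" using v y act_0 by simp
    qed
    show "(\<lambda>x. R `` {x}) ` {x \<in> X. anc x = 0} = X // R"
    proof
      show "X // R \<subseteq> (\<lambda>x. R `` {x}) ` {x \<in> X. anc x = 0}"
      proof
        fix c assume "c \<in> X // R"
        then obtain z where z: "z \<in> X" "c = R `` {z}" by (auto elim: quotientE)
        \<comment> \<open>The representative of the orbit: z moved so that its anchor becomes the
          origin.\<close>
        let ?x = "act (- anc z) z"
        have "act v ?x = act (v - anc z) z" for v using act_act[OF z(1), of v "- anc z"] by simp
        moreover have "act v z = act (v + anc z) ?x" for v using act_act[OF z(1), of "v + anc z" "- anc z"] by simp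
        ultimately have "range (\<lambda>v. act v z) = range (\<lambda>v. act v ?x)"
          by (metis (no_types) image_subsetI rangeI subset_antisym)
        then have "c = R `` {?x}" unfolding z(2) R by (auto simp: image_iff)
        then show "c \<in> (\<lambda>x. R `` {x}) ` {x \<in> X. anc x = 0}"
          using closed[OF z(1)] anc[OF z(1)] by auto
      qed
    qed (auto intro: quotientI)
  qed
  then show ?thesis unfolding count_orbits_def R_def by (simp add: bij_betw_same_card)
qed

definition anchored :: "polygon set \<Rightarrow> nat \<Rightarrow> polygon set" where
  "anchored C m = {P \<in> C. anchor P = 0 \<and> half_perimeter P = m}"

text \<open>By the diameter bound, polygons of half-perimeter m anchored at the origin are sets of
  edges within one fixed finite square.\<close>

lemma finite_anchored:
  assumes "polygon_class C"
  shows "finite (anchored C m)"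
proof (rule finite_subset)
  show "anchored C m \<subseteq> Pow (Pow (square 0 (8 * m + 4)))"
  proof
    fix P assume P: "P \<in> anchored C m"
    then have sap: "self_avoiding_polygon P" using assms by (auto simp: anchored_def polygon_class_def)
    have "\<Union>P \<subseteq> square 0 (8 * m + 4)"
      using polygon_subset_square[OF sap anchor_in[OF sap]] P by (simp add: anchored_def)
    then show "P \<in> Pow (Pow (square 0 (8 * m + 4)))" by blast
  qed
qed (simp add: finite_square)

lemma num_polygons_eq_card:
  assumes "polygon_class C"
  shows "num_polygons C m n = card {P \<in> anchored C m. area P = n}"
proof -
  have "num_polygons C m n = card {P \<in> {P \<in> C. half_perimeter P = m \<and> area P = n}. anchor P = 0}"
    unfolding num_polygons_def
    by (rule count_orbits_eq_card_anchored) (use assms in \<open>auto simp: polygon_class_def anchor_translate\<close>)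
  also have "{P \<in> {P \<in> C. half_perimeter P = m \<and> area P = n}. anchor P = 0} = {P \<in> anchored C m. area P = n}"
    by (auto simp: anchored_def)
  finally show ?thesis .
qed

lemma punctured_translate_mem:
  assumes C: "polygon_class C" and S: "(P, H) \<in> punctured_polygons C r"
  shows "(translate v P, translate v ` H) \<in> punctured_polygons C r"
proof -
  have H: "P \<in> C" "H \<subseteq> C" "finite H" "card H = r"
    "\<And>h. h \<in> H \<Longrightarrow> curve h \<subseteq> inside (curve P) \<and> curve h \<inter> curve P = {}"
    "\<And>h h'. h \<in> H \<Longrightarrow> h' \<in> H \<Longrightarrow> h \<noteq> h' \<Longrightarrow> curve h \<inter> curve h' = {} \<and> cells h \<inter> cells h' = {}"
    using S unfolding punctured_polygons_def by auto
  have "card (translate v ` H) = r"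
    using H(4) card_image[OF inj_on_subset[OF inj_translate]] by blast
  moreover have "\<forall>h\<in>translate v ` H. curve h \<subseteq> inside (curve (translate v P)) \<and> curve h \<inter> curve (translate v P) = {}"
    using H(5) by (simp add: curve_translate inside_translation image_mono flip: image_Int)
  moreover have "\<forall>h\<in>translate v ` H. \<forall>h'\<in>translate v ` H. h \<noteq> h' \<longrightarrow> curve h \<inter> curve h' = {} \<and> cells h \<inter> cells h' = {}"
  proof (intro ballI impI)
    fix h h' assume "h \<in> translate v ` H" "h' \<in> translate v ` H" "h \<noteq> h'"
    then obtain g g' where g: "g \<in> H" "g' \<in> H" "g \<noteq> g'" "h = translate v g" "h' = translate v g'" by blast
    show "curve h \<inter> curve h' = {} \<and> cells h \<inter> cells h' = {}"
      unfolding g(4,5) curve_translate cells_translate using H(6)[OF g(1-3)]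
      by (simp flip: image_Int)
  qed
  moreover have trans: "translate v g \<in> C" if "g \<in> C" for g
    using C that unfolding polygon_class_def by blast
  moreover have "translate v P \<in> C" "translate v ` H \<subseteq> C" "finite (translate v ` H)"
    using H(1-3) trans by auto
  ultimately show ?thesis by (simp only: punctured_polygons_def mem_Collect_eq case_prod_conv simp_thms)
qed

lemma sum_translate:
  fixes g :: "polygon \<Rightarrow> nat"
  assumes "\<And>P. g (translate v P) = g P"
  shows "sum g (translate v ` H) = sum g H"
  using sum.reindex[OF inj_on_subset[OF inj_translate], of H g v] assms by simp

text \<open>The predicate \<open>Q\<close> covers both models at once: equality with s for a
  prescribed total, and the constant truth for arbitrary sizes. A punctured polygon is anchored by
  its outer polygon.\<close>

lemma num_punctured_eq_card:
  assumes C: "polygon_class C" and X: "X = {(P, H) \<in> punctured_polygons C r. Q (\<Sum>h\<in>H. half_perimeter h)}"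
  shows "num_punctured X m n =
    card {S \<in> {S \<in> X. anchor (fst S) = 0 \<and> punctured_half_perimeter S = m}. punctured_area S = n}"
proof -
  let ?Y = "{S \<in> X. punctured_half_perimeter S = m \<and> punctured_area S = n}"
  have "num_punctured X m n = card {S \<in> ?Y. anchor (fst S) = 0}"
    unfolding num_punctured_def
  proof (rule count_orbits_eq_card_anchored)
    fix v S assume S: "S \<in> ?Y"
    obtain P H where PH: "S = (P, H)" by (cases S)
    show "punctured_translate v S \<in> ?Y"
      using S punctured_translate_mem[OF C, of P H r v]
      by (simp add: PH X punctured_translate_def punctured_half_perimeter_def punctured_area_def sum_translate)
    have "self_avoiding_polygon P"
      using S C by (auto simp: PH X punctured_polygons_def polygon_class_def)
    then show "anchor (fst (punctured_translate v S)) = v + anchor (fst S)"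
      by (simp add: PH punctured_translate_def anchor_translate)
  qed (auto simp: punctured_translate_def image_image)
  also have "{S \<in> ?Y. anchor (fst S) = 0} =
     {S \<in> {S \<in> X. anchor (fst S) = 0 \<and> punctured_half_perimeter S = m}. punctured_area S = n}" by blast
  finally show ?thesis .
qed

subsection \<open>Counting the placements of the punctures\<close>

lemma translate_mem: "polygon_class C \<Longrightarrow> P \<in> C \<Longrightarrow> translate v P \<in> C"
  unfolding polygon_class_def by blast

text \<open>The falling factorial. Truncated subtraction is harmless: for n < k the factor with i =
  n is already 0.\<close>

definition ffact :: "nat \<Rightarrow> nat \<Rightarrow> nat" where
  "ffact n k = (\<Prod>i<k. n - i)"

lemma ffact_0 [simp]: "ffact n 0 = 1"
  by (simp add: ffact_def)

lemma ffact_Suc: "ffact n (Suc k) = n * ffact (n - 1) k"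
  by (simp add: ffact_def prod.lessThan_Suc_shift del: prod.lessThan_Suc)

lemma ffact_le_power: "ffact n k \<le> n ^ k"
proof -
  have "ffact n k \<le> (\<Prod>i<k. n)" unfolding ffact_def by (intro prod_mono) auto
  then show ?thesis by simp
qed

lemma ffact_mono: "n \<le> n' \<Longrightarrow> ffact n k \<le> ffact n' k"
  unfolding ffact_def by (intro prod_mono) auto

lemma power_le_ffact: "(n - k) ^ k \<le> ffact n k"
proof -
  have "(\<Prod>i<k. n - k) \<le> ffact n k" unfolding ffact_def by (intro prod_mono) auto
  then show ?thesis by simp
qed

section \<open>Coefficients of the generating functions as sums over anchored objects\<close>

lemma fps_nth_q_deriv_funpow: "fps_nth ((q_deriv ^^ k) Q) m = (pderiv ^^ k) (fps_nth Q m)"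
  by (induction k) (simp_all add: q_deriv_def)

lemma poly_higher_pderiv_monom_1:
  "poly ((pderiv ^^ k) (monom (a :: real) n)) 1 = a * real (ffact n k)"
proof (induction k arbitrary: a n)
  case 0
  then show ?case by (simp add: poly_monom)
next
  case (Suc k)
  have "(pderiv ^^ Suc k) (monom a n) = (pderiv ^^ k) (monom (of_nat n * a) (n - 1))"
    by (simp only: funpow_Suc_right comp_def pderiv_monom)
  then show ?case using Suc.IH by (simp add: ffact_Suc)
qed

text \<open>The k-th derivative of q^n at q = 1 is the falling factorial of n; the sum over values n
  is then regrouped into a sum over the objects by the fibres of the weight \<open>w\<close>. It
  serves both the plain area and the area minus the holes.\<close>

lemma fps_nth_factorial_moment_gf:
  assumes S: "finite S" and c: "\<And>n. c m n = card {x \<in> S. w x = n}"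
  shows "fps_nth (factorial_moment_gf (generating_function c) k) m =
    (-1) ^ k / fact k * real (\<Sum>x\<in>S. ffact (w x) k)"
proof -
  have ne: "{n. c m n \<noteq> 0} = w ` S" using S by (auto simp: c)
  have "poly ((pderiv ^^ k) (\<Sum>n | c m n \<noteq> 0. monom (real (c m n)) n)) 1 =
      (\<Sum>n | c m n \<noteq> 0. real (c m n) * real (ffact n k))"
    by (simp add: higher_pderiv_sum poly_sum poly_higher_pderiv_monom_1)
  also have "\<dots> = (\<Sum>n\<in>w ` S. \<Sum>x\<in>{x \<in> S. w x = n}. real (ffact (w x) k))"
    unfolding ne by (intro sum.cong refl) (simp add: c)
  also have "\<dots> = (\<Sum>x\<in>S. real (ffact (w x) k))"
    by (rule sum.image_gen[OF S, symmetric])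
  finally show ?thesis
    by (simp add: factorial_moment_gf_def eval_q1_def fps_nth_q_deriv_funpow generating_function_def)
qed

lemma fps_nth_eval_q1:
  assumes "finite S" "\<And>n. c m n = card {x \<in> S. w x = n}"
  shows "fps_nth (eval_q1 (generating_function c)) m = real (card S)"
  using fps_nth_factorial_moment_gf[where k = 0 and S = S and c = c and m = m and w = w] assms
  by (simp add: factorial_moment_gf_def)

lemma suminf_area:
  fixes g :: "nat \<Rightarrow> real"
  assumes C: "polygon_class C"
  shows "(\<Sum>n. g n * real (num_polygons C m n)) = (\<Sum>P\<in>anchored C m. g (area P))"
proof -
  note fin = finite_anchored[OF C, of m]
  have "(\<Sum>n. g n * real (num_polygons C m n)) =
      (\<Sum>n\<in>area ` anchored C m. g n * real (num_polygons C m n))"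
    by (rule suminf_finite) (use fin in \<open>auto simp: num_polygons_eq_card[OF C]\<close>)
  also have "\<dots> = (\<Sum>n\<in>area ` anchored C m. \<Sum>P\<in>{P \<in> anchored C m. area P = n}. g (area P))"
    by (intro sum.cong refl) (simp add: num_polygons_eq_card[OF C])
  also have "\<dots> = (\<Sum>P\<in>anchored C m. g (area P))"
    by (rule sum.image_gen[OF fin, symmetric])
  finally show ?thesis .
qed

lemma area_moment_eq:
  "polygon_class C \<Longrightarrow> area_moment C k m = (\<Sum>P\<in>anchored C m. real (area P) ^ k)"
  unfolding area_moment_def by (rule suminf_area)

lemma fps_nth_perimeter_gf:
  "polygon_class C \<Longrightarrow> fps_nth (perimeter_gf C) m = real (card (anchored C m))"
  using suminf_area[of C "\<lambda>_. 1" m] by (simp add: perimeter_gf_def)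

text \<open>Ordered r-tuples of hole shapes up to separate translations. This is the combinatorial
  meaning of the coefficient of x^s in P(x)^r, by splitting off the first shape and the Cauchy
  product.\<close>

definition anchored_lists :: "polygon set \<Rightarrow> nat \<Rightarrow> nat \<Rightarrow> polygon list set" where
  "anchored_lists C r s = {bs. length bs = r \<and> (\<forall>b\<in>set bs. b \<in> C \<and> anchor b = 0) \<and>
     sum_list (map half_perimeter bs) = s}"

lemma anchored_lists_Suc:
  "anchored_lists C (Suc r) s =
     (\<Union>i\<in>{0..s}. (\<lambda>(b, bs). b # bs) ` (anchored C i \<times> anchored_lists C r (s - i)))"
proof (intro equalityI subsetI)
  fix cs assume cs: "cs \<in> anchored_lists C (Suc r) s"
  then obtain b bs where "cs = b # bs" by (auto simp: anchored_lists_def length_Suc_conv)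
  then show "cs \<in> (\<Union>i\<in>{0..s}. (\<lambda>(b, bs). b # bs) ` (anchored C i \<times> anchored_lists C r (s - i)))"
    using cs by (auto simp: anchored_lists_def anchored_def intro!: bexI[of _ "half_perimeter b"])
next
  fix cs assume "cs \<in> (\<Union>i\<in>{0..s}. (\<lambda>(b, bs). b # bs) ` (anchored C i \<times> anchored_lists C r (s - i)))"
  then obtain i b bs where "i \<le> s" "b \<in> anchored C i" "bs \<in> anchored_lists C r (s - i)" "cs = b # bs"
    by auto
  then show "cs \<in> anchored_lists C (Suc r) s"
    by (simp add: anchored_lists_def anchored_def)
qed

lemma finite_anchored_lists:
  assumes "polygon_class C"
  shows "finite (anchored_lists C r s)"
proof (induction r arbitrary: s)
  case 0
  have "anchored_lists C 0 s \<subseteq> {[]}" by (auto simp: anchored_lists_def)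
  then show ?case using finite_subset by blast
next
  case (Suc r)
  then show ?case unfolding anchored_lists_Suc using finite_anchored[OF assms] by auto
qed

lemma fps_nth_perimeter_gf_power:
  assumes "polygon_class C"
  shows "fps_nth (perimeter_gf C ^ r) s = real (card (anchored_lists C r s))"
proof (induction r arbitrary: s)
  case 0
  have "anchored_lists C 0 s = (if s = 0 then {[]} else {})" by (auto simp: anchored_lists_def)
  then show ?case by simp
next
  case (Suc r)
  have "card (anchored_lists C (Suc r) s) =
      (\<Sum>i=0..s. card ((\<lambda>(b, bs). b # bs) ` (anchored C i \<times> anchored_lists C r (s - i))))"
    unfolding anchored_lists_Suc
  proof (rule card_UN_disjoint)
    show "\<forall>i\<in>{0..s}. finite ((\<lambda>(b, bs). b # bs) ` (anchored C i \<times> anchored_lists C r (s - i)))"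
      using finite_anchored[OF assms] finite_anchored_lists[OF assms] by blast
  qed (auto simp: anchored_def)
  also have "\<dots> = (\<Sum>i=0..s. card (anchored C i) * card (anchored_lists C r (s - i)))"
    by (intro sum.cong refl) (subst card_image, auto simp: inj_on_def card_cartesian_product)
  finally show ?case
    by (simp add: fps_mult_nth fps_nth_perimeter_gf[OF assms] Suc.IH)
qed

section \<open>Placements of holes in a fixed outer polygon\<close>

definition hole_sets :: "polygon set \<Rightarrow> nat \<Rightarrow> nat \<Rightarrow> polygon \<Rightarrow> polygon set set" where
  "hole_sets C r s P = {H. (P, H) \<in> punctured_polygons_sum C r s}"

definition hole_lists :: "polygon set \<Rightarrow> nat \<Rightarrow> nat \<Rightarrow> polygon \<Rightarrow> polygon list set" where
  "hole_lists C r s P = {hs. distinct hs \<and> set hs \<in> hole_sets C r s P}"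

text \<open>Every vertex of a hole lies inside the outer curve and is thus the corner of one of its
  cells, so a hole is a family of sets of cells of \<open>P\<close>.\<close>

lemma finite_punctures:
  assumes C: "polygon_class C" and P: "P \<in> C"
  shows "finite {H. (P, H) \<in> punctured_polygons C r}"
proof (rule finite_subset)
  have sap: "self_avoiding_polygon P" using C P by (simp add: polygon_class_def)
  show "{H. (P, H) \<in> punctured_polygons C r} \<subseteq> Pow (Pow (Pow (cells P)))"
  proof clarify
    fix H h e a b assume H: "(P, H) \<in> punctured_polygons C r" "h \<in> H" "e \<in> h" "(a, b) \<in> e"
    then have "curve h \<subseteq> inside (curve P)" by (simp add: punctured_polygons_def)
    then show "(a, b) \<in> cells P"
      using H inside_vertex_in_cells[OF sap] vertex_in_curve by blast
  qed
  show "finite (Pow (Pow (Pow (cells P))))" using finite_cells[OF sap] by simp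
qed

lemma finite_hole_sets:
  assumes "polygon_class C" "P \<in> C"
  shows "finite (hole_sets C r s P)"
  by (rule finite_subset[OF _ finite_punctures[OF assms, of r]])
    (auto simp: hole_sets_def punctured_polygons_sum_def)

text \<open>Passing to ordered holes removes the symmetry: a set of r holes has r! orderings. This
  is the source of the factor 1/r! in the amplitude series.\<close>

lemma card_hole_lists:
  assumes "polygon_class C" "P \<in> C"
  shows "card (hole_lists C r s P) = fact r * card (hole_sets C r s P)" "finite (hole_lists C r s P)"
proof -
  have eq: "hole_lists C r s P = (\<Union>H\<in>hole_sets C r s P. permutations_of_set H)"
    by (auto simp: hole_lists_def permutations_of_set_def)
  have H: "finite H \<and> card H = r" if "H \<in> hole_sets C r s P" for H
    using that by (auto simp: hole_sets_def punctured_polygons_sum_def punctured_polygons_def)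
  have "card (hole_lists C r s P) = (\<Sum>H\<in>hole_sets C r s P. card (permutations_of_set H))"
    unfolding eq
  proof (rule card_UN_disjoint[OF finite_hole_sets[OF assms]])
    show "\<forall>H\<in>hole_sets C r s P. \<forall>H'\<in>hole_sets C r s P. H \<noteq> H' \<longrightarrow>
        permutations_of_set H \<inter> permutations_of_set H' = {}"
      by (auto dest: permutations_of_setD(1))
  qed simp
  also have "\<dots> = (\<Sum>H\<in>hole_sets C r s P. fact r)"
    using H by (intro sum.cong refl) auto
  finally show "card (hole_lists C r s P) = fact r * card (hole_sets C r s P)" by simp
  show "finite (hole_lists C r s P)" unfolding eq using finite_hole_sets[OF assms] by auto
qed

text \<open>An ordered hole configuration is determined by the anchored shapes of its holes and by
  their anchors, and each anchor is one of the \<open>area P\<close> cells of the outer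
  polygon.\<close>

lemma card_hole_sets_le:
  assumes C: "polygon_class C" and P: "P \<in> C"
  shows "fact r * card (hole_sets C r s P) \<le> card (anchored_lists C r s) * area P ^ r"
proof -
  have sap: "self_avoiding_polygon P" if "P \<in> C" for P using C that by (simp add: polygon_class_def)
  let ?norm = "\<lambda>h. translate (- anchor h) h"
  let ?L = "{vs. set vs \<subseteq> cells P \<and> length vs = r}"
  let ?F = "\<lambda>hs. (map ?norm hs, map anchor hs)"
  have zip: "zip (map f xs) (map g xs) = map (\<lambda>x. (f x, g x)) xs"
    for f :: "polygon \<Rightarrow> polygon" and g :: "polygon \<Rightarrow> vertex" and xs
    by (induction xs) auto
  have "inj_on ?F (hole_lists C r s P)"
  proof (rule inj_onI)
    fix hs gs assume "?F hs = ?F gs"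
    then have "map (\<lambda>h. (?norm h, anchor h)) hs = map (\<lambda>h. (?norm h, anchor h)) gs"
      unfolding zip[symmetric] by simp
    note eq = this
    \<comment> \<open>A hole is recovered from the pair because its shape is the hole translated by
      the negative of its anchor.\<close>
    have inj: "inj (\<lambda>h. (?norm h, anchor h))"
    proof (rule injI)
      fix h g assume "(?norm h, anchor h) = (?norm g, anchor g)"
      then have both: "?norm h = ?norm g \<and> anchor h = anchor g" unfolding prod.inject .
      note norm = conjunct1[OF both] and anc = conjunct2[OF both]
      show "h = g" by (rule injD[OF inj_translate norm[unfolded anc]])
    qed
    show "hs = gs" by (rule injD[OF inj_mapI[OF inj] eq])
  qed
  moreover have "?F ` hole_lists C r s P \<subseteq> anchored_lists C r s \<times> ?L"
  proof clarify
    fix hs assume "hs \<in> hole_lists C r s P"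
    then have hs: "distinct hs" "set hs \<subseteq> C" "card (set hs) = r" "(\<Sum>h\<in>set hs. half_perimeter h) = s"
      "\<And>h. h \<in> set hs \<Longrightarrow> curve h \<subseteq> inside (curve P)"
      by (auto simp: hole_lists_def hole_sets_def punctured_polygons_sum_def punctured_polygons_def)
    have len: "length hs = r" using hs(1,3) by (simp add: distinct_card)
    have "sum_list (map half_perimeter hs) = s" using hs(1,4) by (simp add: sum_list_distinct_conv_sum_set)
    moreover have "?norm h \<in> C \<and> anchor (?norm h) = 0" if "h \<in> set hs" for h
      using that hs(2) sap[of h] translate_mem[OF C, of h "- anchor h"] by (auto simp: anchor_translate)
    ultimately have "map ?norm hs \<in> anchored_lists C r s"
      using len by (auto simp: anchored_lists_def comp_def)
    moreover have "anchor h \<in> cells P" if "h \<in> set hs" for h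
      using hs(2) hs(5)[OF that] that vertex_in_curve[OF anchor_in[OF sap[of h]]]
      by (intro inside_vertex_in_cells sap[OF P]) auto
    ultimately show "map ?norm hs \<in> anchored_lists C r s \<and> map anchor hs \<in> ?L"
      using len by auto
  qed
  moreover have "finite (anchored_lists C r s \<times> ?L)"
    using finite_anchored_lists[OF C] finite_lists_length_eq[OF finite_cells[OF sap[OF P]]] by simp
  ultimately have "card (hole_lists C r s P) \<le> card (anchored_lists C r s \<times> ?L)"
    by (rule card_inj_on_le)
  also have "\<dots> = card (anchored_lists C r s) * area P ^ r"
    using card_lists_length_eq[OF finite_cells[OF sap[OF P]], of r] by (simp add: card_cartesian_product area_def)
  finally show ?thesis using card_hole_lists(1)[OF C P] by simp
qed

text \<open>Ordered positions that are pairwise at distance more than d. Requiring this for earlier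
  against later entries suffices because nearness is symmetric.\<close>

definition spread_lists :: "vertex set \<Rightarrow> nat \<Rightarrow> nat \<Rightarrow> vertex list set" where
  "spread_lists G d r = {vs. length vs = r \<and> set vs \<subseteq> G \<and> sorted_wrt (\<lambda>u v. u \<notin> square v d) vs}"

text \<open>Greedy choice: each position already taken forbids at most (2 * d + 1)^2 others.\<close>

lemma card_spread_lists:
  assumes "finite G"
  shows "(card G - r * (2 * d + 1)\<^sup>2) ^ r \<le> card (spread_lists G d r)"
proof -
  \<comment> \<open>The induction keeps one q that dominates the loss at every stage, so all r
    choices contribute the same factor \<open>card G - q\<close>.\<close>
  have "(card G - q) ^ r \<le> card (spread_lists G d r)" if "r * (2 * d + 1)\<^sup>2 \<le> q" for q
    using that
  proof (induction r)
    case 0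
    have "spread_lists G d 0 = {[]}" by (auto simp: spread_lists_def)
    then show ?case by simp
  next
    case (Suc r)
    have fin: "finite (spread_lists G d r)" for r
      by (rule finite_subset[OF _ finite_lists_length_eq[OF assms, of r]]) (auto simp: spread_lists_def)
    define N where "N vs = G - (\<Union>v\<in>set vs. square v d)" for vs
    have N: "card G - q \<le> card (N vs)" if "vs \<in> spread_lists G d r" for vs
    proof -
      have "card (\<Union>v\<in>set vs. square v d) \<le> (\<Sum>v\<in>set vs. card (square v d))"
        by (rule card_UN_le) simp
      also have "\<dots> = card (set vs) * (2 * d + 1)\<^sup>2" by (simp add: card_square)
      also have "\<dots> \<le> r * (2 * d + 1)\<^sup>2"
        using that card_length[of vs] by (intro mult_right_mono) (auto simp: spread_lists_def)
      also have "\<dots> \<le> q" using Suc.prems by simp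
      finally have "card G - q \<le> card G - card (\<Union>v\<in>set vs. square v d)" by simp
      also have "\<dots> \<le> card (N vs)" unfolding N_def
        by (rule diff_card_le_card_Diff) (auto intro: finite_square)
      finally show ?thesis .
    qed
    have sub: "(\<lambda>(vs, v). v # vs) ` (SIGMA vs:spread_lists G d r. N vs) \<subseteq> spread_lists G d (Suc r)"
      by (auto simp: spread_lists_def N_def)
    have "(card G - q) ^ Suc r \<le> card (spread_lists G d r) * (card G - q)"
      using Suc by (simp add: mult.commute)
    also have "\<dots> = (\<Sum>vs\<in>spread_lists G d r. card G - q)" by simp
    also have "\<dots> \<le> (\<Sum>vs\<in>spread_lists G d r. card (N vs))" by (rule sum_mono[OF N])
    also have "\<dots> = card (SIGMA vs:spread_lists G d r. N vs)"
      using fin assms by (subst card_SigmaI) (auto simp: N_def)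
    also have "\<dots> = card ((\<lambda>(vs, v). v # vs) ` (SIGMA vs:spread_lists G d r. N vs))"
      by (rule card_image[symmetric]) (auto simp: inj_on_def)
    also have "\<dots> \<le> card (spread_lists G d (Suc r))" by (rule card_mono[OF fin sub])
    finally show ?case .
  qed
  then show ?thesis by simp
qed

text \<open>Each of the at most 4 * \<open>half_perimeter P\<close> + 2 vertices spoils at most (2 *
  d + 1)^2 cells, so the loss is linear in the half-perimeter.\<close>

lemma card_deep_cells:
  assumes sap: "self_avoiding_polygon P"
  shows "area P - (4 * half_perimeter P + 2) * (2 * d + 1)\<^sup>2 \<le> card {c \<in> cells P. square c d \<inter> \<Union>P = {}}"
proof -
  let ?S = "\<Union>u\<in>\<Union>P. square u d"
  have "card ?S \<le> (\<Sum>u\<in>\<Union>P. card (square u d))"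
    by (rule card_UN_le) (rule polygon_vertices(1)[OF sap])
  also have "\<dots> = card (\<Union>P) * (2 * d + 1)\<^sup>2" by (simp add: card_square)
  also have "\<dots> \<le> (4 * half_perimeter P + 2) * (2 * d + 1)\<^sup>2"
    by (intro mult_right_mono polygon_vertices(4)[OF sap]) simp
  finally have "area P - (4 * half_perimeter P + 2) * (2 * d + 1)\<^sup>2 \<le> area P - card ?S" by simp
  also have "\<dots> \<le> card (cells P - ?S)" unfolding area_def
    by (rule diff_card_le_card_Diff) (use polygon_vertices(1)[OF sap] finite_square in blast)
  also have "cells P - ?S = {c \<in> cells P. square c d \<inter> \<Union>P = {}}"
    using square_sym by blast
  finally show ?thesis .
qed

text \<open>Any shapes may be placed at any positions deep inside \<open>P\<close> and far apart. A
  hole of half-perimeter at most s with anchor v has its vertices within 8 * s + 4 of v and its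
  curve and inside within d = 8 * s + 5. Hence distance more than 2 * d separates two holes, and a
  vertex-free square of radius d + 1 keeps a hole inside the outer curve.\<close>

lemma card_hole_sets_ge:
  assumes C: "polygon_class C" and P: "P \<in> C"
  shows "card (anchored_lists C r s) *
      card (spread_lists {c \<in> cells P. square c (8 * s + 6) \<inter> \<Union>P = {}} (2 * (8 * s + 5)) r)
    \<le> fact r * card (hole_sets C r s P)"
proof -
  have sap: "self_avoiding_polygon P" if "P \<in> C" for P using C that by (simp add: polygon_class_def)
  define d where "d = 8 * s + 5"
  have d: "8 * s + 6 = Suc d" "8 * s + 5 = d" by (simp_all add: d_def)
  let ?G = "{c \<in> cells P. square c (8 * s + 6) \<inter> \<Union>P = {}}"
  let ?X = "anchored_lists C r s \<times> spread_lists ?G (2 * (8 * s + 5)) r"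
  let ?F = "\<lambda>(bs, vs). map2 translate vs bs"
  have nth: "map2 translate vs bs ! i = translate (vs ! i) (bs ! i)"
    if "(bs, vs) \<in> ?X" "i < r" for bs vs i
    using that by (auto simp: anchored_lists_def spread_lists_def)
  have len: "length (map2 translate vs bs) = r" "length vs = r" "length bs = r" if "(bs, vs) \<in> ?X" for bs vs
    using that by (auto simp: anchored_lists_def spread_lists_def)
  have b: "bs ! i \<in> C" "anchor (bs ! i) = 0" if "(bs, vs) \<in> ?X" "i < r" for bs vs i
    using that by (auto simp: anchored_lists_def)
  \<comment> \<open>The shapes are anchored at 0, so the anchors of the placed holes return the
    positions; the shapes are then recovered by translating back.\<close>
  have anc: "map anchor (map2 translate vs bs) = vs" if X: "(bs, vs) \<in> ?X" for bs vs
  proof (rule nth_equalityI)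
    fix i assume "i < length (map anchor (map2 translate vs bs))"
    then have i: "i < r" using len[OF X] by simp
    then show "map anchor (map2 translate vs bs) ! i = vs ! i"
      using nth[OF X i] b[OF X i] len[OF X] by (simp add: anchor_translate[OF sap])
  qed (use len[OF X] in simp)
  have "inj_on ?F ?X"
  proof (rule inj_onI)
    fix x y assume xy: "x \<in> ?X" "y \<in> ?X" "?F x = ?F y"
    obtain bs vs where x: "x = (bs, vs)" by (cases x)
    obtain cs ws where y: "y = (cs, ws)" by (cases y)
    have eq: "map2 translate vs bs = map2 translate ws cs" using xy(3) by (simp add: x y)
    note X = xy(1)[unfolded x] and Y = xy(2)[unfolded y]
    have vw: "vs = ws" using anc[OF X] anc[OF Y] eq by simp
    have "bs = cs"
    proof (rule nth_equalityI)
      fix i assume "i < length bs"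
      then have i: "i < r" using len[OF X] by simp
      have "translate (vs ! i) (bs ! i) = translate (vs ! i) (cs ! i)"
        using nth[OF X i] nth[OF Y i] eq vw by simp
      then show "bs ! i = cs ! i" using inj_translate[of "vs ! i"] by (simp add: inj_eq)
    qed (use len[OF X] len[OF Y] in simp)
    then show "x = y" by (simp add: x y vw)
  qed
  moreover have "?F ` ?X \<subseteq> hole_lists C r s P"
  proof
    fix hs assume "hs \<in> ?F ` ?X"
    then obtain bs vs where X: "(bs, vs) \<in> ?X" and hs: "hs = map2 translate vs bs" by auto
    note [simp] = len[OF X]
    have hnth: "hs ! i = translate (vs ! i) (bs ! i)" if "i < r" for i using nth[OF X that] hs by simp
    have lhs: "length hs = r" by (simp add: hs)
    have idx: "\<exists>i<r. h = hs ! i" if "h \<in> set hs" for h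
      using that unfolding in_set_conv_nth lhs by blast
    have far: "big_square (vs ! i) d \<inter> big_square (vs ! j) d = {}" "vs ! i \<noteq> vs ! j"
      if "i < r" "j < r" "i \<noteq> j" for i j
    proof -
      have *: "u < w \<Longrightarrow> w < r \<Longrightarrow> vs ! u \<notin> square (vs ! w) (2 * d)" for u w
        using X by (simp add: spread_lists_def sorted_wrt_iff_nth_less d)
      have n: "vs ! i \<notin> square (vs ! j) (2 * d)"
        using *[of i j] *[of j i] that square_sym by (cases "i < j") auto
      show "big_square (vs ! i) d \<inter> big_square (vs ! j) d = {}" by (rule big_square_disjoint[OF n])
      show "vs ! i \<noteq> vs ! j" using n by (auto simp: square_def mem_Times_iff)
    qed
    have hole: "hs ! i \<in> C" "curve (hs ! i) \<subseteq> big_square (vs ! i) d" "inside (curve (hs ! i)) \<subseteq> big_square (vs ! i) d"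
      if i: "i < r" for i
    proof -
      show hC: "hs ! i \<in> C" using hnth[OF i] b(1)[OF X i] translate_mem[OF C] by simp
      have "sum_list (map half_perimeter bs) = s" using X by (simp add: anchored_lists_def)
      then have "half_perimeter (bs ! i) \<le> s"
        using elem_le_sum_list[of i "map half_perimeter bs"] i by simp
      then have "8 * half_perimeter (hs ! i) + 4 \<le> 8 * s + 4" using hnth[OF i] by simp
      then have "square (vs ! i) (8 * half_perimeter (hs ! i) + 4) \<subseteq> square (vs ! i) (8 * s + 4)"
        by (rule square_mono)
      moreover have "anchor (hs ! i) = vs ! i"
        using hnth[OF i] b[OF X i] by (simp add: anchor_translate[OF sap])
      ultimately have sub: "\<Union>(hs ! i) \<subseteq> square (vs ! i) (8 * s + 4)"
        using polygon_subset_square[OF sap[OF hC] anchor_in[OF sap[OF hC]]] by simp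
      have "Suc (8 * s + 4) = d" by (simp add: d_def)
      then show "curve (hs ! i) \<subseteq> big_square (vs ! i) d" "inside (curve (hs ! i)) \<subseteq> big_square (vs ! i) d"
        using curve_subset_big_square[OF sap[OF hC] sub] inside_subset_big_square[OF sap[OF hC] sub] by simp_all
    qed
    have "distinct vs" using far(2) by (auto simp: distinct_conv_nth)
    then have dist: "distinct hs" using anc[OF X] hs by (metis distinct_map)
    have in_P: "curve h \<subseteq> inside (curve P) \<and> curve h \<inter> curve P = {}" if mem: "h \<in> set hs" for h
    proof -
      obtain i where i: "i < r" "h = hs ! i" using idx[OF mem] by blast
      have "vs \<in> spread_lists ?G (2 * (8 * s + 5)) r" using X by (simp only: mem_Sigma_iff)
      then have "set vs \<subseteq> ?G" by (simp only: spread_lists_def mem_Collect_eq)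
      moreover have "vs ! i \<in> set vs" using i(1) len(2)[OF X] by simp
      ultimately have "vs ! i \<in> ?G" by (rule subsetD)
      then have "big_square (vs ! i) d \<subseteq> inside (curve P)"
        by (intro big_square_subset_inside sap[OF P]) (auto simp: d(1), simp add: d_def)
      then show ?thesis using hole(2)[OF i(1)] i(2) inside_no_overlap[of "curve P"] by blast
    qed
    have disj: "curve h \<inter> curve h' = {} \<and> cells h \<inter> cells h' = {}"
      if mem: "h \<in> set hs" "h' \<in> set hs" "h \<noteq> h'" for h h'
    proof -
      obtain i where i: "i < r" "h = hs ! i" using idx[OF mem(1)] by blast
      obtain j where j: "j < r" "h' = hs ! j" using idx[OF mem(2)] by blast
      have "i \<noteq> j" using mem(3) i j by auto
      note sq = far(1)[OF i(1) j(1) this]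
      \<comment> \<open>The midpoint of a common cell would lie in two disjoint squares. This also
        rules out nested holes.\<close>
      have "cells h \<inter> cells h' = {}"
      proof (rule ccontr)
        assume "cells h \<inter> cells h' \<noteq> {}"
        then obtain c where "c \<in> cells h" "c \<in> cells h'" by blast
        then have "(of_int (fst c) + 1/2, of_int (snd c) + 1/2) \<in> inside (curve h) \<inter> inside (curve h')"
          using cell_midpoint[of c] unfolding cells_def by blast
        then show False using hole(3)[OF i(1)] hole(3)[OF j(1)] i(2) j(2) sq by blast
      qed
      then show ?thesis using hole(2)[OF i(1)] hole(2)[OF j(1)] i(2) j(2) sq by blast
    qed
    have "set hs \<subseteq> C" using idx hole(1) by blast
    moreover have "card (set hs) = r" using dist lhs by (simp add: distinct_card)
    moreover have "(\<Sum>h\<in>set hs. half_perimeter h) = s"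
    proof -
      have "map half_perimeter hs = map half_perimeter bs"
        by (rule nth_equalityI) (simp_all add: lhs hnth)
      then show ?thesis using X dist
        by (simp add: anchored_lists_def flip: sum_list_distinct_conv_sum_set)
    qed
    ultimately show "hs \<in> hole_lists C r s P"
      using dist in_P disj P unfolding hole_lists_def hole_sets_def punctured_polygons_sum_def punctured_polygons_def
      by simp
  qed
  ultimately have "card ?X \<le> card (hole_lists C r s P)"
    by (rule card_inj_on_le) (rule card_hole_lists(2)[OF C P])
  then show ?thesis using card_hole_lists(1)[OF C P] by (simp add: card_cartesian_product)
qed

subsection \<open>Area moments\<close>

text \<open>For a > b this is Bernoulli's inequality at - b / a, scaled by a^j. For a \<le> b the
  truncated difference is 0 and the other side is at most 0, because a \<le> j * b.\<close>

lemma power_diff_ge_bernoulli: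
  fixes a b :: nat
  assumes "j \<ge> 1"
  shows "real ((a - b) ^ j) \<ge> real a ^ j - real j * real b * real a ^ (j - 1)"
proof -
  obtain i where j: "j = Suc i" using assms by (cases j) auto
  have split: "real a ^ j = real a * real a ^ (j - 1)" by (simp add: j)
  show ?thesis
  proof (cases "a > b")
    case True
    have "1 + real j * (- (real b / real a)) \<le> (1 + - (real b / real a)) ^ j"
      by (rule Bernoulli_inequality) (use True in \<open>simp add: field_simps\<close>)
    then have "real a ^ j * (1 - real j * (real b / real a)) \<le> real a ^ j * (1 - real b / real a) ^ j"
      by (intro mult_left_mono) auto
    also have "\<dots> = (real a - real b) ^ j"
      using True by (simp add: field_simps flip: power_mult_distrib)
    also have "real a ^ j * (1 - real j * (real b / real a)) = real a ^ j - real j * real b * real a ^ (j - 1)"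
      using True by (simp add: split field_simps)
    finally show ?thesis using True by (simp add: of_nat_diff)
  next
    case False
    have "real a * real a ^ (j - 1) \<le> (real j * real b) * real a ^ (j - 1)"
    proof (rule mult_right_mono)
      have "real a \<le> 1 * real b" using False by simp
      also have "\<dots> \<le> real j * real b" using assms by (intro mult_right_mono) auto
      finally show "real a \<le> real j * real b" .
    qed simp
    moreover have "0 \<le> real ((a - b) ^ j)" by (rule of_nat_0_le_iff)
    ultimately show ?thesis using split by linarith
  qed
qed

section \<open>Factorial moments against power moments, without punctures\<close>

definition factorial_moment :: "polygon set \<Rightarrow> nat \<Rightarrow> nat \<Rightarrow> nat" where
  "factorial_moment C k m = (\<Sum>P\<in>anchored C m. ffact (area P) k)"

lemma fps_nth_factorial_moment_gf_polygons:
  assumes "polygon_class C"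
  shows "fps_nth (factorial_moment_gf (generating_function (num_polygons C)) k) m =
    (-1) ^ k / fact k * real (factorial_moment C k m)"
  unfolding factorial_moment_def
  by (rule fps_nth_factorial_moment_gf[OF finite_anchored[OF assms]]) (rule num_polygons_eq_card[OF assms])

lemma factorial_moment_le:
  "polygon_class C \<Longrightarrow> real (factorial_moment C k m) \<le> area_moment C k m"
  unfolding factorial_moment_def area_moment_eq of_nat_sum of_nat_power[symmetric]
  by (intro sum_mono of_nat_mono ffact_le_power)

lemma area_moment_nonneg: "polygon_class C \<Longrightarrow> area_moment C k m \<ge> 0"
  by (simp add: area_moment_eq sum_nonneg)

text \<open>Every factor of the falling factorial is at least the area minus k, so the difference to
  the k-th power costs only a constant times the moment of order k - 1.\<close>

lemma factorial_moment_ge: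
  assumes "polygon_class C" "k \<ge> 1"
  shows "area_moment C k m - real k * real k * area_moment C (k - 1) m \<le> real (factorial_moment C k m)"
proof -
  have "area_moment C k m - real k * real k * area_moment C (k - 1) m =
      (\<Sum>P\<in>anchored C m. real (area P) ^ k - real k * real k * real (area P) ^ (k - 1))"
    by (simp add: area_moment_eq[OF assms(1)] sum_subtractf sum_distrib_left)
  also have "\<dots> \<le> (\<Sum>P\<in>anchored C m. real (ffact (area P) k))"
  proof (rule sum_mono)
    fix P
    have "real (area P) ^ k - real k * real k * real (area P) ^ (k - 1) \<le> real ((area P - k) ^ k)"
      by (rule power_diff_ge_bernoulli[OF assms(2)])
    also have "\<dots> \<le> real (ffact (area P) k)" by (intro of_nat_mono power_le_ffact)
    finally show "real (area P) ^ k - real k * real k * real (area P) ^ (k - 1) \<le> real (ffact (area P) k)" .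
  qed
  finally show ?thesis by (simp add: factorial_moment_def)
qed

section \<open>Moments of the punctured models\<close>

definition anchored_punctured :: "punctured set \<Rightarrow> nat \<Rightarrow> punctured set" where
  "anchored_punctured X m = {S \<in> X. anchor (fst S) = 0 \<and> punctured_half_perimeter S = m}"

definition punctured_moment :: "punctured set \<Rightarrow> nat \<Rightarrow> nat \<Rightarrow> nat" where
  "punctured_moment X k m = (\<Sum>S\<in>anchored_punctured X m. ffact (punctured_area S) k)"

lemma finite_anchored_punctured:
  assumes C: "polygon_class C" and X: "X \<subseteq> punctured_polygons C r"
  shows "finite (anchored_punctured X m)"
proof (rule finite_subset)
  show "anchored_punctured X m \<subseteq>
    (SIGMA P:(\<Union>i\<in>{..m}. anchored C i). {H. (P, H) \<in> punctured_polygons C r})"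
  proof
    fix S assume S: "S \<in> anchored_punctured X m"
    obtain P H where PH: "S = (P, H)" by (cases S)
    have mem: "(P, H) \<in> punctured_polygons C r" "anchor P = 0" "half_perimeter P \<le> m"
      using S X by (auto simp: PH anchored_punctured_def punctured_half_perimeter_def)
    then have "P \<in> anchored C (half_perimeter P)"
      by (simp add: anchored_def punctured_polygons_def)
    then show "S \<in> (SIGMA P:(\<Union>i\<in>{..m}. anchored C i). {H. (P, H) \<in> punctured_polygons C r})"
      using mem by (auto simp: PH)
  qed
  show "finite (SIGMA P:(\<Union>i\<in>{..m}. anchored C i). {H. (P, H) \<in> punctured_polygons C r})"
  proof (rule finite_SigmaI)
    show "finite (\<Union>i\<in>{..m}. anchored C i)" using finite_anchored[OF C] by blast
    fix P assume "P \<in> (\<Union>i\<in>{..m}. anchored C i)"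
    then show "finite {H. (P, H) \<in> punctured_polygons C r}"
      by (intro finite_punctures[OF C]) (auto simp: anchored_def)
  qed
qed

lemma fps_nth_factorial_moment_gf_punctured:
  assumes C: "polygon_class C" and X: "X = {(P, H) \<in> punctured_polygons C r. Q (\<Sum>h\<in>H. half_perimeter h)}"
  shows "fps_nth (factorial_moment_gf (generating_function (num_punctured X)) k) m =
    (-1) ^ k / fact k * real (punctured_moment X k m)"
  unfolding punctured_moment_def
proof (rule fps_nth_factorial_moment_gf)
  show "finite (anchored_punctured X m)" by (rule finite_anchored_punctured[OF C, of X r]) (auto simp: X)
  show "num_punctured X m n = card {S \<in> anchored_punctured X m. punctured_area S = n}" for n
    unfolding anchored_punctured_def by (rule num_punctured_eq_card[OF C X])
qed

text \<open>With the holes' total half-perimeter fixed at s, total half-perimeter m + s means outer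
  half-perimeter m. This shift is the origin of the factor xc^s.\<close>

lemma punctured_moment_sum_shift:
  assumes C: "polygon_class C"
  shows "punctured_moment (punctured_polygons_sum C r s) k (m + s) =
    (\<Sum>P\<in>anchored C m. \<Sum>H\<in>hole_sets C r s P. ffact (area P - (\<Sum>h\<in>H. area h)) k)"
proof -
  have "anchored_punctured (punctured_polygons_sum C r s) (m + s) = (SIGMA P:anchored C m. hole_sets C r s P)"
    by (auto simp: anchored_punctured_def hole_sets_def anchored_def punctured_polygons_sum_def
        punctured_half_perimeter_def punctured_polygons_def)
  moreover have "\<forall>P\<in>anchored C m. finite (hole_sets C r s P)"
    using finite_hole_sets[OF C] by (simp add: anchored_def)
  ultimately show ?thesis
    unfolding punctured_moment_def using finite_anchored[OF C, of m]
    by (simp add: sum.Sigma punctured_area_def case_prod_unfold)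
qed

lemma punctured_moment_sum_eq_0:
  assumes "m < s"
  shows "punctured_moment (punctured_polygons_sum C r s) k m = 0"
proof -
  have "anchored_punctured (punctured_polygons_sum C r s) m = {}"
    using assms by (auto simp: anchored_punctured_def punctured_polygons_sum_def punctured_half_perimeter_def)
  then show ?thesis by (simp add: punctured_moment_def)
qed

lemma punctured_moment_total:
  assumes C: "polygon_class C" and "m \<le> M"
  shows "punctured_moment (punctured_polygons C r) k m =
    (\<Sum>s\<le>M. punctured_moment (punctured_polygons_sum C r s) k m)"
proof -
  have "anchored_punctured (punctured_polygons C r) m =
      (\<Union>s\<in>{..M}. anchored_punctured (punctured_polygons_sum C r s) m)"
    using assms(2) by (auto simp: anchored_punctured_def punctured_polygons_sum_def punctured_half_perimeter_def)
  then show ?thesis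
    unfolding punctured_moment_def
  proof (simp only:, intro sum.UNION_disjoint)
    show "\<forall>s\<in>{..M}. finite (anchored_punctured (punctured_polygons_sum C r s) m)"
      by (intro ballI finite_anchored_punctured[OF C, of _ r]) (auto simp: punctured_polygons_sum_def)
  qed (auto simp: anchored_punctured_def punctured_polygons_sum_def)
qed

text \<open>Dropping the holes' areas bounds each weight by the k-th power of the outer area, and
  the number of placements supplies r further powers.\<close>

lemma punctured_moment_sum_le:
  assumes C: "polygon_class C"
  shows "fact r * real (punctured_moment (punctured_polygons_sum C r s) k (m + s)) \<le>
    fps_nth (perimeter_gf C ^ r) s * area_moment C (k + r) m"
proof -
  have "fact r * punctured_moment (punctured_polygons_sum C r s) k (m + s) \<le>
      (\<Sum>P\<in>anchored C m. card (anchored_lists C r s) * area P ^ (k + r))"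
    unfolding punctured_moment_sum_shift[OF C] sum_distrib_left
  proof (rule sum_mono)
    fix P assume "P \<in> anchored C m"
    then have P: "P \<in> C" by (simp add: anchored_def)
    have "(\<Sum>H\<in>hole_sets C r s P. ffact (area P - (\<Sum>h\<in>H. area h)) k) \<le> (\<Sum>H\<in>hole_sets C r s P. area P ^ k)"
      by (intro sum_mono order_trans[OF ffact_mono ffact_le_power]) simp
    then have "fact r * (\<Sum>H\<in>hole_sets C r s P. ffact (area P - (\<Sum>h\<in>H. area h)) k) \<le>
        (fact r * card (hole_sets C r s P)) * area P ^ k"
      by simp
    also have "\<dots> \<le> (card (anchored_lists C r s) * area P ^ r) * area P ^ k"
      by (intro mult_right_mono card_hole_sets_le[OF C P]) simp
    finally show "(\<Sum>H\<in>hole_sets C r s P. fact r * ffact (area P - (\<Sum>h\<in>H. area h)) k) \<le>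
        card (anchored_lists C r s) * area P ^ (k + r)"
      by (simp add: sum_distrib_left power_add mult_ac)
  qed
  then have "real (fact r * punctured_moment (punctured_polygons_sum C r s) k (m + s)) \<le>
      real (\<Sum>P\<in>anchored C m. card (anchored_lists C r s) * area P ^ (k + r))"
    by (rule of_nat_mono)
  then show ?thesis
    by (simp add: area_moment_eq[OF C] fps_nth_perimeter_gf_power[OF C] sum_distrib_left)
qed

text \<open>The squares count the lattice points of balls: 16 * s + 13 is the side for radius 8 * s
  + 6 around a boundary vertex, 32 * s + 21 the side for radius 2 * (8 * s + 5) around another
  hole.\<close>

lemma card_hole_sets_ge_power:
  assumes C: "polygon_class C" and P: "P \<in> C"
  shows "card (anchored_lists C r s) *
      (area P - ((4 * half_perimeter P + 2) * (16 * s + 13)\<^sup>2 + r * (32 * s + 21)\<^sup>2)) ^ r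
    \<le> fact r * card (hole_sets C r s P)"
proof -
  have sap: "self_avoiding_polygon P" using C P by (simp add: polygon_class_def)
  let ?G = "{c \<in> cells P. square c (8 * s + 6) \<inter> \<Union>P = {}}"
  have "area P - ((4 * half_perimeter P + 2) * (16 * s + 13)\<^sup>2 + r * (32 * s + 21)\<^sup>2) \<le>
      card ?G - r * (2 * (2 * (8 * s + 5)) + 1)\<^sup>2"
    using card_deep_cells[OF sap, of "8 * s + 6"] by (simp add: algebra_simps)
  then have "(area P - ((4 * half_perimeter P + 2) * (16 * s + 13)\<^sup>2 + r * (32 * s + 21)\<^sup>2)) ^ r \<le>
      card (spread_lists ?G (2 * (8 * s + 5)) r)"
    using finite_cells[OF sap] by (intro order_trans[OF power_mono card_spread_lists]) auto
  then show ?thesis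
    using card_hole_sets_ge[OF C P, of r s] by (meson le_trans mult_le_mono2)
qed

lemma punctured_moment_sum_ge:
  assumes C: "polygon_class C" and "k + r \<ge> 1"
  obtains K where "\<And>m. fps_nth (perimeter_gf C ^ r) s *
      (area_moment C (k + r) m - K * real (m + 1) * area_moment C (k + r - 1) m) \<le>
    fact r * real (punctured_moment (punctured_polygons_sum C r s) k (m + s))"
proof -
  \<comment> \<open>The summands account for positions lost near the boundary, positions lost near
    other holes, the total area of the holes, and the k units lost from a falling factorial to a
    power. Multiplied by m + 1, the first one dominates the 4 * m + 2 vertices.\<close>
  define K where "K = 4 * (16 * s + 13)\<^sup>2 + r * (32 * s + 21)\<^sup>2 + r * (2 * (8 * s + 5) + 1)\<^sup>2 + k"
  have nat_bound: "(\<Sum>P\<in>anchored C m. card (anchored_lists C r s) * (area P - K * (m + 1)) ^ (k + r)) \<le>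
      fact r * punctured_moment (punctured_polygons_sum C r s) k (m + s)" for m
    unfolding punctured_moment_sum_shift[OF C] sum_distrib_left
  proof (rule sum_mono)
    fix P assume "P \<in> anchored C m"
    then have P: "P \<in> C" "half_perimeter P = m" by (simp_all add: anchored_def)
    have K1: "K * (m + 1) \<ge> (4 * m + 2) * (16 * s + 13)\<^sup>2 + r * (32 * s + 21)\<^sup>2"
      unfolding K_def by (simp add: algebra_simps)
    have K2: "K * (m + 1) \<ge> r * (2 * (8 * s + 5) + 1)\<^sup>2 + k"
      unfolding K_def by (simp add: algebra_simps)
    have ffact: "(area P - K * (m + 1)) ^ k \<le> ffact (area P - (\<Sum>h\<in>H. area h)) k"
      if H: "H \<in> hole_sets C r s P" for H
    proof -
      have H': "H \<subseteq> C" "finite H" "card H = r" "(\<Sum>h\<in>H. half_perimeter h) = s"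
        using H by (auto simp: hole_sets_def punctured_polygons_sum_def punctured_polygons_def)
      have "area h \<le> (2 * (8 * s + 5) + 1)\<^sup>2" if "h \<in> H" for h
      proof -
        have "half_perimeter h \<le> s" using H'(2,4) that member_le_sum[of h H half_perimeter] by simp
        then have "(2 * (8 * half_perimeter h + 5) + 1)\<^sup>2 \<le> (2 * (8 * s + 5) + 1)\<^sup>2"
          by (intro power_mono) auto
        moreover have "area h \<le> (2 * (8 * half_perimeter h + 5) + 1)\<^sup>2"
          using C H'(1) that by (intro area_le) (auto simp: polygon_class_def)
        ultimately show ?thesis by (rule le_trans[rotated])
      qed
      then have "(\<Sum>h\<in>H. area h) \<le> r * (2 * (8 * s + 5) + 1)\<^sup>2"
        using sum_bounded_above[of H area "(2 * (8 * s + 5) + 1)\<^sup>2"] H'(3) by simp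
      then have "area P - K * (m + 1) \<le> area P - (\<Sum>h\<in>H. area h) - k" using K2 by linarith
      then show ?thesis
        by (intro order_trans[OF power_mono power_le_ffact]) auto
    qed
    have "card (anchored_lists C r s) * (area P - K * (m + 1)) ^ (k + r) =
        card (anchored_lists C r s) * (area P - K * (m + 1)) ^ r * (area P - K * (m + 1)) ^ k"
      by (simp add: power_add mult_ac)
    also have "\<dots> \<le> card (anchored_lists C r s) *
        (area P - ((4 * m + 2) * (16 * s + 13)\<^sup>2 + r * (32 * s + 21)\<^sup>2)) ^ r * (area P - K * (m + 1)) ^ k"
      using K1 by (intro mult_right_mono mult_left_mono power_mono diff_le_mono2) auto
    also have "\<dots> \<le> fact r * card (hole_sets C r s P) * (area P - K * (m + 1)) ^ k"
      using card_hole_sets_ge_power[OF C P(1), of r s] P(2) by (intro mult_right_mono) auto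
    also have "\<dots> = fact r * (\<Sum>H\<in>hole_sets C r s P. (area P - K * (m + 1)) ^ k)" by simp
    also have "\<dots> \<le> fact r * (\<Sum>H\<in>hole_sets C r s P. ffact (area P - (\<Sum>h\<in>H. area h)) k)"
      by (intro mult_left_mono sum_mono ffact) auto
    finally show "card (anchored_lists C r s) * (area P - K * (m + 1)) ^ (k + r) \<le>
        (\<Sum>H\<in>hole_sets C r s P. fact r * ffact (area P - (\<Sum>h\<in>H. area h)) k)"
      by (simp add: sum_distrib_left)
  qed
  show ?thesis
  \<comment> \<open>The factor k + r is the exponent in Bernoulli's inequality.\<close>
  proof (rule that[of "real (k + r) * real K"])
    fix m
    let ?W = "card (anchored_lists C r s)" and ?j = "k + r"
    have "area_moment C ?j m - real ?j * real K * real (m + 1) * area_moment C (?j - 1) m =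
      (\<Sum>P\<in>anchored C m. real (area P) ^ ?j - real ?j * real (K * (m + 1)) * real (area P) ^ (?j - 1))"
      unfolding area_moment_eq[OF C] sum_distrib_left sum_subtractf[symmetric] of_nat_mult
      by (simp only: mult.assoc)
    also have "\<dots> \<le> (\<Sum>P\<in>anchored C m. real ((area P - K * (m + 1)) ^ ?j))"
      by (intro sum_mono power_diff_ge_bernoulli assms(2))
    finally have "real ?W * (area_moment C ?j m - real ?j * real K * real (m + 1) * area_moment C (?j - 1) m) \<le>
        real ?W * (\<Sum>P\<in>anchored C m. real ((area P - K * (m + 1)) ^ ?j))"
      by (intro mult_left_mono) auto
    also have "\<dots> = real (\<Sum>P\<in>anchored C m. ?W * (area P - K * (m + 1)) ^ ?j)"
      by (simp add: sum_distrib_left)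
    also have "\<dots> \<le> real (fact r * punctured_moment (punctured_polygons_sum C r s) k (m + s))"
      by (rule of_nat_mono[OF nat_bound])
    finally show "fps_nth (perimeter_gf C ^ r) s *
      (area_moment C ?j m - real ?j * real K * real (m + 1) * area_moment C (?j - 1) m) \<le>
      fact r * real (punctured_moment (punctured_polygons_sum C r s) k (m + s))"
      by (simp add: fps_nth_perimeter_gf_power[OF C])
  qed
qed

subsection \<open>Power series near a dominant singularity\<close>

lemma fps_conv_radius_ge_of_bound:
  fixes u v :: "real fps"
  assumes "eventually (\<lambda>m. \<bar>fps_nth v m\<bar> \<le> B * fps_nth u m) sequentially"
  shows "fps_conv_radius v \<ge> fps_conv_radius u"
  unfolding fps_conv_radius_def
proof (rule conv_radius_geI_ex)
  fix r :: real assume r: "0 < r" "ereal r < conv_radius (fps_nth u)"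
  have "summable (\<lambda>n. B * (fps_nth u n * r ^ n))"
    using r by (intro summable_mult summable_in_conv_radius) simp
  moreover have "eventually (\<lambda>n. norm (fps_nth v n * r ^ n) \<le> B * (fps_nth u n * r ^ n)) sequentially"
    using assms
  proof eventually_elim
    case (elim n)
    then have "\<bar>fps_nth v n\<bar> * r ^ n \<le> B * fps_nth u n * r ^ n"
      using r by (intro mult_right_mono) auto
    then show ?case using r by (simp add: abs_mult)
  qed
  ultimately have "summable (\<lambda>n. fps_nth v n * r ^ n)" by (rule summable_comparison_test_ev[rotated])
  then show "\<exists>z. norm z = r \<and> summable (\<lambda>n. fps_nth v n * z ^ n)" using r by (intro exI[of _ r]) auto
qed

lemma eventually_at_left_pos:
  assumes "(c::real) > 0"
  shows "eventually (\<lambda>x. 0 < x \<and> x < c) (at_left c)"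
  using eventually_at_left_real[OF assms] by simp

lemma fps_conv_radius_gtD: "ereal c \<le> fps_conv_radius u \<Longrightarrow> 0 < x \<and> x < c \<Longrightarrow> ereal (norm x) < fps_conv_radius u"
  for x c :: real and u :: "real fps"
  by (rule less_le_trans[of _ "ereal c"]) auto

lemma eval_fps_mono:
  fixes u v :: "real fps"
  assumes "ereal c \<le> fps_conv_radius u" "ereal c \<le> fps_conv_radius v" "0 < x \<and> x < c"
    and "\<And>m. fps_nth u m \<le> fps_nth v m"
  shows "eval_fps u x \<le> eval_fps v x"
  unfolding eval_fps_def
proof (rule suminf_le)
  show "summable (\<lambda>n. fps_nth u n * x ^ n)" "summable (\<lambda>n. fps_nth v n * x ^ n)"
    using assms(1-3) by (auto intro!: summable_fps fps_conv_radius_gtD)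
  show "fps_nth u n * x ^ n \<le> fps_nth v n * x ^ n" for n
    using assms(3,4) by (intro mult_right_mono) auto
qed

lemma eval_fps_cmult:
  fixes u :: "real fps"
  assumes "ereal (norm x) < fps_conv_radius u"
  shows "eval_fps (fps_const a * u) x = a * eval_fps u x"
  using eval_fps_mult[of x "fps_const a" u] assms by simp

text \<open>Up to finitely many terms v differs from l * u by at most d * u, coefficient by
  coefficient. The exceptional terms contribute a bounded amount, which is negligible because u
  diverges at c.\<close>

lemma eval_fps_ratio_tendsto:
  fixes u v :: "real fps"
  assumes c: "c > 0" and radius: "ereal c \<le> fps_conv_radius u" "ereal c \<le> fps_conv_radius v"
    and u_nonneg: "\<And>m. fps_nth u m \<ge> 0"
    and u_pos: "eventually (\<lambda>m. fps_nth u m > 0) sequentially"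
    and lim: "(\<lambda>m. fps_nth v m / fps_nth u m) \<longlonglongrightarrow> l"
    and diverges: "filterlim (eval_fps u) at_top (at_left c)"
  shows "((\<lambda>x. eval_fps v x / eval_fps u x) \<longlongrightarrow> l) (at_left c)"
proof (rule tendstoI)
  fix e :: real assume "e > 0"
  \<comment> \<open>One third covers the tail, another the bounded part B, and the last makes the
    inequality strict.\<close>
  define d where "d = e / 3"
  have d: "d > 0" using \<open>e > 0\<close> by (simp add: d_def)
  have "eventually (\<lambda>m. \<bar>fps_nth v m - l * fps_nth u m\<bar> \<le> d * fps_nth u m) sequentially"
    using tendstoD[OF lim d] u_pos
  proof eventually_elim
    case (elim m)
    then have "\<bar>fps_nth v m / fps_nth u m - l\<bar> * fps_nth u m \<le> d * fps_nth u m"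
      by (intro mult_right_mono) (auto simp: dist_real_def)
    moreover have "\<bar>fps_nth v m / fps_nth u m - l\<bar> * fps_nth u m = \<bar>(fps_nth v m / fps_nth u m - l) * fps_nth u m\<bar>"
      using elim(2) by (simp add: abs_mult)
    moreover have "(fps_nth v m / fps_nth u m - l) * fps_nth u m = fps_nth v m - l * fps_nth u m"
      using elim(2) by (simp add: field_simps)
    ultimately show ?case by simp
  qed
  then obtain M where M: "\<And>m. m \<ge> M \<Longrightarrow> \<bar>fps_nth v m - l * fps_nth u m\<bar> \<le> d * fps_nth u m"
    by (auto simp: eventually_sequentially)
  \<comment> \<open>The initial terms are measured at c instead of x, so that their sum B bounds
    them uniformly for x < c.\<close>
  define b where "b m = (if m < M then \<bar>fps_nth v m - l * fps_nth u m\<bar> * c ^ m else 0)" for m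
  define B where "B = (\<Sum>m. b m)"
  have sum_b: "summable b" by (rule summable_finite[of "{..<M}"]) (auto simp: b_def)
  have b_nonneg: "b m \<ge> 0" for m using c by (simp add: b_def)
  then have B: "B \<ge> 0" unfolding B_def by (intro suminf_nonneg sum_b)
  have bound: "\<bar>eval_fps v x - l * eval_fps u x\<bar> \<le> d * eval_fps u x + B" if x: "0 < x \<and> x < c" for x
  proof -
    have su: "summable (\<lambda>n. fps_nth u n * x ^ n)" and sv: "summable (\<lambda>n. fps_nth v n * x ^ n)"
      using radius x by (auto intro!: summable_fps fps_conv_radius_gtD)
    let ?w = "\<lambda>n. fps_nth v n * x ^ n - l * (fps_nth u n * x ^ n)"
    have sr: "summable (\<lambda>n. d * (fps_nth u n * x ^ n) + b n)"
      by (intro summable_add summable_mult su sum_b)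
    have le: "norm (?w n) \<le> d * (fps_nth u n * x ^ n) + b n" for n
    proof -
      have w: "norm (?w n) = \<bar>fps_nth v n - l * fps_nth u n\<bar> * x ^ n"
      proof -
        have "?w n = (fps_nth v n - l * fps_nth u n) * x ^ n" by (simp add: algebra_simps)
        then show ?thesis using x by (simp add: abs_mult)
      qed
      show ?thesis
      proof (cases "n < M")
        case True
        have "\<bar>fps_nth v n - l * fps_nth u n\<bar> * x ^ n \<le> \<bar>fps_nth v n - l * fps_nth u n\<bar> * c ^ n"
          using x by (intro mult_left_mono power_mono) auto
        moreover have "d * (fps_nth u n * x ^ n) \<ge> 0" using d u_nonneg x by simp
        ultimately show ?thesis using True unfolding w b_def by simp
      next
        case False
        then have "\<bar>fps_nth v n - l * fps_nth u n\<bar> * x ^ n \<le> d * fps_nth u n * x ^ n"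
          using x M by (intro mult_right_mono) auto
        then show ?thesis using False unfolding w b_def by simp
      qed
    qed
    have "eval_fps v x - l * eval_fps u x = (\<Sum>n. ?w n)"
      unfolding eval_fps_def using suminf_diff[OF sv summable_mult[OF su, of l]] suminf_mult[OF su, of l] by simp
    also have "\<bar>\<dots>\<bar> \<le> (\<Sum>n. d * (fps_nth u n * x ^ n) + b n)"
    proof -
      have sw: "summable (\<lambda>n. norm (?w n))"
        by (rule summable_comparison_test[OF _ sr]) (use le in auto)
      show ?thesis using summable_norm[OF sw] suminf_le[OF le sw sr] by simp
    qed
    also have "\<dots> = d * eval_fps u x + B"
      unfolding eval_fps_def B_def
      using suminf_add[OF summable_mult[OF su, of d] sum_b] suminf_mult[OF su, of d] by simp
    finally show ?thesis .
  qed
  have "eventually (\<lambda>x. eval_fps u x > B / d) (at_left c)"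
    using diverges by (simp add: filterlim_at_top_dense)
  with eventually_at_left_pos[OF c]
  show "eventually (\<lambda>x. dist (eval_fps v x / eval_fps u x) l < e) (at_left c)"
  proof eventually_elim
    case (elim x)
    have "0 \<le> B / d" using B d by simp
    then have pos: "eval_fps u x > 0" using elim(2) by linarith
    have "B < d * eval_fps u x" using elim(2) d by (simp add: field_simps)
    then have "\<bar>eval_fps v x - l * eval_fps u x\<bar> < 3 * d * eval_fps u x"
      using bound[OF elim(1)] pos d mult_pos_pos[OF d pos] by linarith
    moreover have "eval_fps v x / eval_fps u x - l = (eval_fps v x - l * eval_fps u x) / eval_fps u x"
      using pos by (simp add: field_simps)
    ultimately show ?case using pos by (simp add: dist_real_def d_def divide_less_eq)
  qed
qed

lemma critical_value_eq_0:
  assumes "filterlim (eval_fps g) at_infinity (at_left xc)"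
  shows "critical_value g xc = 0"
  using not_tendsto_and_filterlim_at_infinity[OF _ _ assms] by (auto simp: critical_value_def)

subsection \<open>Amplitude series\<close>

locale polygon_model =
  fixes C :: "polygon set" and A \<gamma> f :: "nat \<Rightarrow> real" and xc \<theta> \<phi> :: real
  assumes C: "polygon_class C"
    and xc: "xc > 0" and \<phi>: "0 < \<phi>" "\<phi> < 1"
    and A: "\<And>k. A k > 0"
    and \<gamma>: "\<And>k. \<gamma> k = (real k - \<theta>) / \<phi>"
    and \<gamma>_gt: "\<And>k. \<gamma> k > -1"
    and moments: "\<And>k. (\<lambda>m. area_moment C k m)
               \<sim>[sequentially] (\<lambda>m. A k * xc powr (- real m) * real m powr (\<gamma> k - 1))"
    and f: "\<And>k. f k = (-1) ^ k / fact k * A k * xc powr \<gamma> k * Gamma (\<gamma> k)"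
    and series: "has_area_amplitude_series (generating_function (num_polygons C)) f \<gamma>"
begin

lemma \<gamma>_pos:
  assumes "j \<ge> 1"
  shows "\<gamma> j > 0"
proof -
  have "\<theta> < \<phi>" using \<gamma>_gt[of 0] \<phi> by (simp add: \<gamma> field_simps)
  then show ?thesis using assms \<phi> by (simp add: \<gamma>)
qed

abbreviation "mom j \<equiv> Abs_fps (area_moment C j)"
abbreviation "fmom j \<equiv> Abs_fps (\<lambda>m. real (factorial_moment C j m))"
abbreviation "pmom X k \<equiv> Abs_fps (\<lambda>m. real (punctured_moment X k m))"

text \<open>The singular term of the unsigned factorial moment series: undoing the normalisation
  (-1)^j / j! leaves \<open>A j\<close> * xc^(\<open>\<gamma> j\<close>) *
  Gamma(\<open>\<gamma> j\<close>) as coefficient, which is positive for j \<ge> 1.\<close>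

definition pole :: "nat \<Rightarrow> real \<Rightarrow> real" where
  "pole j x = (-1) ^ j * fact j * f j * (xc - x) powr (- \<gamma> j)"

lemma area_moment_pos: "eventually (\<lambda>m. area_moment C j m > 0) sequentially"
proof -
  have "eventually (\<lambda>m::nat. A j * xc powr (- real m) * real m powr (\<gamma> j - 1) > 0) sequentially"
    using eventually_gt_at_top[of 0] 
  proof eventually_elim
    case (elim m)
    then show ?case using A[of j] xc by (intro mult_pos_pos) auto
  qed
  with asymp_equiv_eventually_pos_iff[OF moments[of j]]
  show ?thesis by (rule eventually_elim2) simp
qed

text \<open>Lowering the order by one lowers the exponent of m by p = 1/\<phi> > 1, which outweighs
  the factor m + 1. This is where \<phi> < 1 enters.\<close>

lemma area_moment_ratio:
  assumes "j \<ge> 1"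
  shows "(\<lambda>m. real (m + 1) * area_moment C (j - 1) m / area_moment C j m) \<longlonglongrightarrow> 0"
proof -
  let ?g = "\<lambda>j m. A j * xc powr (- real m) * real m powr (\<gamma> j - 1)"
  define p where "p = 1 / \<phi>"
  have p: "p > 1" using \<phi> by (simp add: p_def)
  have d: "\<gamma> (j - 1) - 1 = (\<gamma> j - 1) - p"
    using assms \<phi> by (simp add: \<gamma> p_def of_nat_diff field_simps)
  have "(\<lambda>m. real (m + 1) * area_moment C (j - 1) m / area_moment C j m)
      \<sim>[sequentially] (\<lambda>m. real (m + 1) * ?g (j - 1) m / ?g j m)"
    by (intro asymp_equiv_intros moments)
  moreover have "(\<lambda>m. real (m + 1) * ?g (j - 1) m / ?g j m) \<longlonglongrightarrow> 0"
  proof (rule Lim_transform_eventually)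
    show "(\<lambda>m. A (j - 1) / A j * (real (m + 1) * real m powr (- p))) \<longlonglongrightarrow> 0"
      using p by real_asymp
    show "eventually (\<lambda>m. A (j - 1) / A j * (real (m + 1) * real m powr (- p)) =
        real (m + 1) * ?g (j - 1) m / ?g j m) sequentially"
      using eventually_gt_at_top[of 0]
    proof eventually_elim
      case (elim m)
      have "real m powr (\<gamma> (j - 1) - 1) = real m powr (\<gamma> j - 1) * real m powr (- p)"
        unfolding d by (simp flip: powr_add)
      then show ?case using A[of j] xc elim by (simp add: field_simps)
    qed
  qed
  ultimately show ?thesis using asymp_equiv_tendsto_transfer asymp_equiv_sym by blast
qed

lemma fmom_ratio:
  assumes "j \<ge> 1"
  shows "(\<lambda>m. real (factorial_moment C j m) / area_moment C j m) \<longlonglongrightarrow> 1"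
proof (rule tendsto_sandwich)
  show "(\<lambda>m. 1 - real j * real j * (real (m + 1) * area_moment C (j - 1) m / area_moment C j m)) \<longlonglongrightarrow> 1"
    using tendsto_diff[OF tendsto_const tendsto_mult[OF tendsto_const area_moment_ratio[OF assms]],
        of 1 "real j * real j"] by (simp only: mult_zero_right diff_zero)
  show "eventually (\<lambda>m. real (factorial_moment C j m) / area_moment C j m \<le> 1) sequentially"
    using area_moment_pos[of j] by eventually_elim (simp add: factorial_moment_le[OF C])
  show "eventually (\<lambda>m. 1 - real j * real j * (real (m + 1) * area_moment C (j - 1) m / area_moment C j m)
      \<le> real (factorial_moment C j m) / area_moment C j m) sequentially"
    using area_moment_pos[of j]
  proof eventually_elim
    case (elim m)
    \<comment> \<open>The error has no factor m + 1; inserting one only weakens the bound and brings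
      it to the form covered by \<open>area_moment_ratio\<close>.\<close>
    have "real j * real j * (1 * area_moment C (j - 1) m) \<le> real j * real j * (real (m + 1) * area_moment C (j - 1) m)"
      using area_moment_nonneg[OF C] by (intro mult_left_mono mult_right_mono) auto
    then have "area_moment C j m - real j * real j * (real (m + 1) * area_moment C (j - 1) m) \<le> real (factorial_moment C j m)"
      using factorial_moment_ge[OF C assms, of m] by simp
    then have "(area_moment C j m - real j * real j * (real (m + 1) * area_moment C (j - 1) m)) / area_moment C j m
       \<le> real (factorial_moment C j m) / area_moment C j m"
      using elim by (intro divide_right_mono) auto
    then show ?case using elim by (simp add: diff_divide_distrib)
  qed
qed simp

lemma fmom_pos:
  assumes "j \<ge> 1"
  shows "eventually (\<lambda>m. real (factorial_moment C j m) > 0) sequentially"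
proof -
  have "eventually (\<lambda>m. real (factorial_moment C j m) / area_moment C j m > 0) sequentially"
    by (rule order_tendstoD(1)[OF fmom_ratio[OF assms]]) simp
  with area_moment_pos[of j] show ?thesis
    by eventually_elim (simp add: zero_less_divide_iff)
qed

section \<open>The unpunctured series at the critical point\<close>

lemma eval_q1_polygons: "eval_q1 (generating_function (num_polygons C)) = perimeter_gf C"
proof (rule fps_ext)
  show "fps_nth (eval_q1 (generating_function (num_polygons C))) m = fps_nth (perimeter_gf C) m" for m
    using fps_nth_eval_q1[where S = "anchored C m" and w = area and c = "num_polygons C" and m = m]
      finite_anchored[OF C] num_polygons_eq_card[OF C]
    by (simp add: fps_nth_perimeter_gf[OF C])
qed

lemma perimeter_gf_eq_mom: "perimeter_gf C = mom 0"
  by (rule fps_ext) (simp add: fps_nth_perimeter_gf[OF C] area_moment_eq[OF C])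

text \<open>The amplitude hypothesis only provides some radius; the ratio test on the asymptotics of
  order 0 identifies it with \<open>xc\<close>.\<close>

lemma radius_perimeter: "fps_conv_radius (perimeter_gf C) = ereal xc"
proof -
  let ?g = "\<lambda>m. A 0 * xc powr (- real m) * real m powr (\<gamma> 0 - 1)"
  define p where "p = \<gamma> 0 - 1"
  have "(\<lambda>m. area_moment C 0 m / area_moment C 0 (Suc m)) \<sim>[sequentially] (\<lambda>m. ?g m / ?g (Suc m))"
    by (intro asymp_equiv_intros moments asymp_equiv_compose'[OF moments filterlim_Suc])
  moreover have "(\<lambda>m. ?g m / ?g (Suc m)) \<longlonglongrightarrow> xc"
  proof (rule Lim_transform_eventually)
    show "(\<lambda>m. xc * (real m powr p / real (Suc m) powr p)) \<longlonglongrightarrow> xc"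
      by real_asymp
    show "eventually (\<lambda>m. xc * (real m powr p / real (Suc m) powr p) = ?g m / ?g (Suc m)) sequentially"
      using eventually_gt_at_top[of 0]
    proof eventually_elim
      case (elim m)
      have "xc powr (- real m) = xc * xc powr (- real (Suc m))"
        using xc powr_add[of xc 1 "- real (Suc m)"] by simp
      then show ?case using A[of 0] xc elim by (simp add: p_def field_simps)
    qed
  qed
  ultimately have "(\<lambda>m. area_moment C 0 m / area_moment C 0 (Suc m)) \<longlonglongrightarrow> xc"
    using asymp_equiv_tendsto_transfer asymp_equiv_sym by blast
  then have "(\<lambda>m. norm (area_moment C 0 m) / norm (area_moment C 0 (Suc m))) \<longlonglongrightarrow> xc"
    using area_moment_nonneg[OF C] by simp
  then show ?thesis
    unfolding perimeter_gf_eq_mom fps_conv_radius_def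
    using area_moment_pos[of 0]
    by (intro conv_radius_ratio_limit_ereal) (auto elim: eventually_mono)
qed

lemma series_at_xc:
  "fps_conv_radius (factorial_moment_gf (generating_function (num_polygons C)) k) = ereal xc"
  "(\<lambda>x. eval_fps (factorial_moment_gf (generating_function (num_polygons C)) k) x -
      critical_value (factorial_moment_gf (generating_function (num_polygons C)) k) xc)
     \<sim>[at_left xc] (\<lambda>x. f k * (xc - x) powr (- \<gamma> k))"
  using series radius_perimeter unfolding has_area_amplitude_series_def eval_q1_polygons by auto

lemma factorial_moment_gf_eq:
  "factorial_moment_gf (generating_function (num_polygons C)) k = fps_const ((-1) ^ k / fact k) * fmom k"
  by (rule fps_ext) (simp add: fps_nth_factorial_moment_gf_polygons[OF C])

lemma radius_fmom: "fps_conv_radius (fmom k) = ereal xc"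
  using series_at_xc(1)[of k] unfolding factorial_moment_gf_eq
  by (simp add: fps_conv_radius_cmult_left)

text \<open>The amplitude hypothesis gives the radius for factorial moments only; eventually the
  power moments are at most twice as large.\<close>

lemma radius_mom:
  assumes "j \<ge> 1"
  shows "fps_conv_radius (mom j) \<ge> ereal xc"
  unfolding radius_fmom[of j, symmetric]
proof (rule fps_conv_radius_ge_of_bound)
  have "eventually (\<lambda>m. real (factorial_moment C j m) / area_moment C j m > 1 / 2) sequentially"
    by (rule order_tendstoD(1)[OF fmom_ratio[OF assms]]) simp
  with area_moment_pos[of j]
  show "eventually (\<lambda>m. \<bar>fps_nth (mom j) m\<bar> \<le> 2 * fps_nth (fmom j) m) sequentially"
    by eventually_elim (simp add: field_simps)
qed

lemma pole_at_top:
  assumes "j \<ge> 1"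
  shows "filterlim (pole j) at_top (at_left xc)"
proof -
  have "(-1) ^ j * fact j * f j = A j * xc powr \<gamma> j * Gamma (\<gamma> j)"
    by (simp add: f flip: power_mult_distrib)
  also have "\<dots> > 0" using A[of j] xc \<gamma>_pos[OF assms] by (simp add: Gamma_real_pos)
  finally have c: "(-1) ^ j * fact j * f j > 0" .
  have "filterlim (\<lambda>x. (xc - x) powr (- \<gamma> j)) at_top (at_left xc)"
    using \<gamma>_pos[OF assms] by real_asymp
  then show ?thesis unfolding pole_def by (rule filterlim_tendsto_pos_mult_at_top[OF tendsto_const c])
qed

lemma fmom_pole_ratio:
  assumes "j \<ge> 1"
  shows "((\<lambda>x. eval_fps (fmom j) x / pole j x) \<longlongrightarrow> 1) (at_left xc)"
proof -
  let ?g = "factorial_moment_gf (generating_function (num_polygons C)) j"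
  \<comment> \<open>The rescaled critical value. Whatever it is, a constant divided by the diverging
    \<open>pole j\<close> tends to 0.\<close>
  define a where "a = (-1) ^ j * fact j * critical_value ?g xc"
  have aux: "(-1) ^ j * fact j * ((-1) ^ j / fact j * y) = y" for y :: real
    by (simp flip: power_mult_distrib mult.assoc)
  have "(\<lambda>x. (-1) ^ j * fact j * (eval_fps ?g x - critical_value ?g xc)) \<sim>[at_left xc] pole j"
    unfolding pole_def mult.assoc by (intro asymp_equiv_intros series_at_xc(2))
  moreover have "eventually (\<lambda>x. pole j x > 0) (at_left xc)"
    using pole_at_top[OF assms] by (simp add: filterlim_at_top_dense)
  ultimately have "((\<lambda>x. (-1) ^ j * fact j * (eval_fps ?g x - critical_value ?g xc) / pole j x) \<longlongrightarrow> 1) (at_left xc)"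
    by (intro asymp_equivD_strong) (auto elim: eventually_mono)
  moreover have "((\<lambda>x. a / pole j x) \<longlongrightarrow> 0) (at_left xc)"
    by (rule real_tendsto_divide_at_top[OF tendsto_const pole_at_top[OF assms]])
  ultimately have "((\<lambda>x. (-1) ^ j * fact j * (eval_fps ?g x - critical_value ?g xc) / pole j x + a / pole j x) \<longlongrightarrow> 1 + 0) (at_left xc)"
    by (rule tendsto_add)
  moreover have "eventually (\<lambda>x. (-1) ^ j * fact j * (eval_fps ?g x - critical_value ?g xc) / pole j x + a / pole j x
      = eval_fps (fmom j) x / pole j x) (at_left xc)"
    using eventually_at_left_pos[OF xc]
  proof eventually_elim
    case (elim x)
    have "eval_fps ?g x = (-1) ^ j / fact j * eval_fps (fmom j) x"
      unfolding factorial_moment_gf_eq using radius_fmom[of j] elim by (intro eval_fps_cmult) simp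
    then have "(-1) ^ j * fact j * eval_fps ?g x = eval_fps (fmom j) x" using aux by simp
    then show ?case by (simp add: a_def right_diff_distrib flip: add_divide_distrib)
  qed
  ultimately show ?thesis using Lim_transform_eventually by fastforce
qed

lemma fmom_at_top:
  assumes "j \<ge> 1"
  shows "filterlim (eval_fps (fmom j)) at_top (at_left xc)"
proof -
  have "filterlim (\<lambda>x. eval_fps (fmom j) x / pole j x * pole j x) at_top (at_left xc)"
    by (rule filterlim_tendsto_pos_mult_at_top[OF fmom_pole_ratio[OF assms] _ pole_at_top[OF assms]]) simp
  moreover have "eventually (\<lambda>x. pole j x > 0) (at_left xc)"
    using pole_at_top[OF assms] by (simp add: filterlim_at_top_dense)
  then have ev: "eventually (\<lambda>x. eval_fps (fmom j) x / pole j x * pole j x = eval_fps (fmom j) x) (at_left xc)"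
    by eventually_elim simp
  ultimately show ?thesis by (simp only: filterlim_cong[OF refl refl ev])
qed

text \<open>The common final step of both models, which differ only in c. The amplitudes are (-1)^k
  / k! * c * (-1)^(k + r) * (k + r)! * \<open>f (k + r)\<close>, in which the signs combine to
  (-1)^r and the factorials to the falling factorial. Positivity of c transfers the divergence, so
  all critical values are 0.\<close>

lemma has_area_amplitude_seriesI:
  assumes r: "r \<ge> 1"
    and X: "X = {(P, H) \<in> punctured_polygons C r. Q (\<Sum>h\<in>H. half_perimeter h)}"
    and radius: "\<And>k. fps_conv_radius (pmom X k) \<ge> ereal xc"
    and c: "c > 0"
    and ratio: "\<And>k. ((\<lambda>x. eval_fps (pmom X k) x / eval_fps (fmom (k + r)) x) \<longlongrightarrow> c) (at_left xc)"
  defines "fr \<equiv> \<lambda>k. (-1) ^ r * c * (falling_factorial (real (k + r)) r * f (k + r))"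
  shows "has_area_amplitude_series (generating_function (num_punctured X)) fr (\<lambda>k. \<gamma> (k + r))"
proof -
  define G where "G k = factorial_moment_gf (generating_function (num_punctured X)) k" for k
  have G_eq: "G k = fps_const ((-1) ^ k / fact k) * pmom X k" for k
    by (rule fps_ext) (simp add: G_def fps_nth_factorial_moment_gf_punctured[OF C X])
  have j: "k + r \<ge> 1" for k using r by simp
  have lim: "((\<lambda>x. eval_fps (pmom X k) x / pole (k + r) x) \<longlongrightarrow> c) (at_left xc)" for k
  proof -
    have "((\<lambda>x. eval_fps (pmom X k) x / eval_fps (fmom (k + r)) x * (eval_fps (fmom (k + r)) x / pole (k + r) x)) \<longlongrightarrow> c * 1) (at_left xc)"
      by (intro tendsto_mult ratio fmom_pole_ratio j)
    moreover have "eventually (\<lambda>x. eval_fps (fmom (k + r)) x > 0) (at_left xc)"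
      using fmom_at_top[OF j] by (simp add: filterlim_at_top_dense)
    then have "eventually (\<lambda>x. eval_fps (pmom X k) x / eval_fps (fmom (k + r)) x * (eval_fps (fmom (k + r)) x / pole (k + r) x)
        = eval_fps (pmom X k) x / pole (k + r) x) (at_left xc)"
      by eventually_elim simp
    ultimately show ?thesis using Lim_transform_eventually by fastforce
  qed
  have pole_pos: "eventually (\<lambda>x. pole (k + r) x > 0) (at_left xc)" for k
    using pole_at_top[OF j] by (simp add: filterlim_at_top_dense)
  have at_top: "filterlim (eval_fps (pmom X k)) at_top (at_left xc)" for k
  proof -
    have "filterlim (\<lambda>x. eval_fps (pmom X k) x / pole (k + r) x * pole (k + r) x) at_top (at_left xc)"
      by (rule filterlim_tendsto_pos_mult_at_top[OF lim c pole_at_top[OF j]])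
    moreover have ev: "eventually (\<lambda>x. eval_fps (pmom X k) x / pole (k + r) x * pole (k + r) x = eval_fps (pmom X k) x) (at_left xc)"
      using pole_pos[of k] by eventually_elim simp
    ultimately show ?thesis by (simp only: filterlim_cong[OF refl refl ev])
  qed
  \<comment> \<open>With a larger radius the series would be continuous at \<open>xc\<close> and
    have a finite limit there.\<close>
  have radius_eq: "fps_conv_radius (pmom X k) = ereal xc" for k
  proof (rule antisym[OF _ radius], rule ccontr)
    assume "\<not> fps_conv_radius (pmom X k) \<le> ereal xc"
    then have "continuous (at_left xc) (eval_fps (pmom X k))"
      using xc by (intro continuous_eval_fps) simp
    then have "(eval_fps (pmom X k) \<longlongrightarrow> eval_fps (pmom X k) xc) (at_left xc)"
      by (simp add: continuous_within)
    then show False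
      using not_tendsto_and_filterlim_at_infinity[OF _ _ filterlim_at_top_imp_at_infinity[OF at_top[of k]]] by auto
  qed
  have radius_G: "fps_conv_radius (G k) = ereal xc" for k
    unfolding G_eq using radius_eq[of k] by (simp add: fps_conv_radius_cmult_left)
  have eval_G: "eventually (\<lambda>x. (-1) ^ k / fact k * eval_fps (pmom X k) x = eval_fps (G k) x) (at_left xc)" for k
    using eventually_at_left_pos[OF xc]
    by eventually_elim (simp add: G_eq eval_fps_cmult radius_eq)
  have crit: "critical_value (G k) xc = 0" for k
  proof (rule critical_value_eq_0)
    have "filterlim (\<lambda>x. (-1) ^ k / fact k * eval_fps (pmom X k) x) at_infinity (at_left xc)"
      by (rule tendsto_mult_filterlim_at_infinity[OF tendsto_const _ filterlim_at_top_imp_at_infinity[OF at_top]]) simp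
    then show "filterlim (eval_fps (G k)) at_infinity (at_left xc)"
      by (simp only: filterlim_cong[OF refl refl eval_G[of k]])
  qed
  have asymp: "(\<lambda>x. eval_fps (G k) x - critical_value (G k) xc) \<sim>[at_left xc] (\<lambda>x. fr k * (xc - x) powr (- \<gamma> (k + r)))" for k
  proof -
    have "(\<lambda>x. eval_fps (pmom X k) x) \<sim>[at_left xc] (\<lambda>x. c * pole (k + r) x)"
    proof (rule asymp_equivI')
      have "((\<lambda>x. eval_fps (pmom X k) x / pole (k + r) x / c) \<longlongrightarrow> c / c) (at_left xc)"
        using c by (intro tendsto_divide lim tendsto_const) auto
      then show "((\<lambda>x. eval_fps (pmom X k) x / (c * pole (k + r) x)) \<longlongrightarrow> 1) (at_left xc)"
        using c by (simp add: divide_divide_eq_left mult.commute)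
    qed
    then have "(\<lambda>x. (-1) ^ k / fact k * eval_fps (pmom X k) x) \<sim>[at_left xc] (\<lambda>x. (-1) ^ k / fact k * (c * pole (k + r) x))"
      by (intro asymp_equiv_intros)
    moreover have "(-1) ^ k / fact k * (c * pole (k + r) x) = fr k * (xc - x) powr (- \<gamma> (k + r))" for x
    proof -
      have ff: "falling_factorial (real (k + r)) r * fact k = fact (k + r)"
      proof -
        have "falling_factorial (real (k + r)) r = (\<Prod>i<r. real (k + Suc i))"
          unfolding falling_factorial_def by (subst prod.nat_diff_reindex[symmetric]) (auto intro!: prod.cong simp: of_nat_diff)
        moreover have "(\<Prod>i<r. real (k + Suc i)) * fact k = fact (k + r)"
        proof (induction r)
          case (Suc r)
          have "(\<Prod>i<Suc r. real (k + Suc i)) * fact k = ((\<Prod>i<r. real (k + Suc i)) * fact k) * real (k + Suc r)"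
            by (simp only: prod.lessThan_Suc mult_ac)
          then show ?case unfolding Suc by (simp add: algebra_simps)
        qed simp
        ultimately show ?thesis by simp
      qed
      have sgn: "(-1) ^ k * (-1) ^ (k + r) = ((-1) ^ r :: real)"
        by (simp add: power_add flip: mult.assoc power_mult_distrib)
      have "(-1) ^ k / fact k * (c * pole (k + r) x) =
          ((-1) ^ k * (-1) ^ (k + r)) * c * (fact (k + r) / fact k) * f (k + r) * (xc - x) powr (- \<gamma> (k + r))"
        by (simp add: pole_def)
      also have "fact (k + r) / fact k = falling_factorial (real (k + r)) r" using ff by (simp add: field_simps)
      finally show ?thesis unfolding sgn by (simp add: fr_def mult_ac)
    qed
    ultimately have "(\<lambda>x. (-1) ^ k / fact k * eval_fps (pmom X k) x) \<sim>[at_left xc] (\<lambda>x. fr k * (xc - x) powr (- \<gamma> (k + r)))"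
      by simp
    then show ?thesis
      unfolding crit diff_0_right by (subst (asm) asymp_equiv_cong[OF eval_G[of k] always_eventually[OF allI[OF refl]]])
  qed
  have "G 0 = eval_q1 (generating_function (num_punctured X))"
    by (simp add: G_def factorial_moment_gf_def)
  then have "fps_conv_radius (eval_q1 (generating_function (num_punctured X))) = ereal xc"
    using radius_G[of 0] by simp
  then show ?thesis
    unfolding has_area_amplitude_series_def using xc radius_G asymp unfolding G_def by blast
qed

lemma formal_series_shift:
  "formal_series UNIV (\<lambda>k. (-1) ^ r * c * (falling_factorial (real (k + r)) r * f (k + r))) (\<lambda>k. \<gamma> (k + r)) =
   (\<lambda>b. (-1) ^ r * c * formal_series {r..} (\<lambda>k. falling_factorial (real k) r * f k) \<gamma> b)"
proof
  fix b
  have "bij_betw (\<lambda>k. k + r) {k. k \<in> UNIV \<and> \<gamma> (k + r) = b} {k. k \<in> {r..} \<and> \<gamma> k = b}"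
    by (rule bij_betwI[of _ _ _ "\<lambda>k. k - r"]) auto
  from sum.reindex_bij_betw[OF this, of "\<lambda>k. (-1) ^ r * c * (falling_factorial (real k) r * f k)"]
  show "formal_series UNIV (\<lambda>k. (-1) ^ r * c * (falling_factorial (real (k + r)) r * f (k + r))) (\<lambda>k. \<gamma> (k + r)) b =
    (-1) ^ r * c * formal_series {r..} (\<lambda>k. falling_factorial (real k) r * f k) \<gamma> b"
    unfolding formal_series_def sum_distrib_left by simp
qed

section \<open>Punctures of prescribed total half-perimeter\<close>

lemma perimeter_power_nonneg: "fps_nth (perimeter_gf C ^ r) s \<ge> 0"
  by (simp add: fps_nth_perimeter_gf_power[OF C])

text \<open>Both bounds are relative to the power moment of order k + r, their gap vanishing by
  \<open>area_moment_ratio\<close>; dividing by \<open>fmom_ratio\<close> then replaces it by the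
  factorial moment, whose series has known singular behaviour.\<close>

lemma punctured_shift_ratio:
  assumes r: "r \<ge> 1"
  shows "(\<lambda>m. real (punctured_moment (punctured_polygons_sum C r s) k (m + s)) / real (factorial_moment C (k + r) m))
    \<longlonglongrightarrow> fps_nth (perimeter_gf C ^ r) s / fact r"
proof -
  let ?W = "fps_nth (perimeter_gf C ^ r) s"
  let ?b = "\<lambda>m. real (punctured_moment (punctured_polygons_sum C r s) k (m + s))"
  let ?a = "area_moment C (k + r)"
  have j: "k + r \<ge> 1" using r by simp
  obtain K where K: "\<And>m. ?W * (?a m - K * real (m + 1) * area_moment C (k + r - 1) m) \<le> fact r * ?b m"
    using punctured_moment_sum_ge[OF C j] by metis
  have lim: "(\<lambda>m. ?b m / ?a m) \<longlonglongrightarrow> ?W / fact r"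
  proof (rule tendsto_sandwich)
    show "(\<lambda>m. ?W / fact r * (1 - K * (real (m + 1) * area_moment C (k + r - 1) m / ?a m))) \<longlonglongrightarrow> ?W / fact r"
      using tendsto_mult[OF tendsto_const tendsto_diff[OF tendsto_const tendsto_mult[OF tendsto_const area_moment_ratio[OF j]]],
          of "?W / fact r" 1 K] by (simp only: mult_zero_right diff_zero mult_1_right)
    show "eventually (\<lambda>m. ?W / fact r * (1 - K * (real (m + 1) * area_moment C (k + r - 1) m / ?a m)) \<le> ?b m / ?a m) sequentially"
      using area_moment_pos[of "k + r"]
    proof eventually_elim
      case (elim m)
      have "?W * (?a m - K * real (m + 1) * area_moment C (k + r - 1) m) / (fact r * ?a m) \<le> fact r * ?b m / (fact r * ?a m)"
        using K[of m] elim by (intro divide_right_mono) auto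
      moreover have "?W * (?a m - K * real (m + 1) * area_moment C (k + r - 1) m) / (fact r * ?a m) =
          ?W / fact r * (1 - K * (real (m + 1) * area_moment C (k + r - 1) m / ?a m))"
        using elim by (simp add: field_simps)
      ultimately show ?case by simp
    qed
    show "eventually (\<lambda>m. ?b m / ?a m \<le> ?W / fact r) sequentially"
      using area_moment_pos[of "k + r"]
    proof eventually_elim
      case (elim m)
      then show ?case
        using punctured_moment_sum_le[OF C, of r s k m] by (simp add: field_simps)
    qed
  qed simp
  have "(\<lambda>m. (?b m / ?a m) / (real (factorial_moment C (k + r) m) / ?a m)) \<longlonglongrightarrow> (?W / fact r) / 1"
    by (rule tendsto_divide[OF lim fmom_ratio[OF j]]) simp
  moreover have "eventually (\<lambda>m. (?b m / ?a m) / (real (factorial_moment C (k + r) m) / ?a m) =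
      ?b m / real (factorial_moment C (k + r) m)) sequentially"
    using area_moment_pos[of "k + r"] by eventually_elim simp
  ultimately show ?thesis using Lim_transform_eventually by fastforce
qed

lemma punctured_sum_ratio:
  assumes r: "r \<ge> 1"
  shows "fps_conv_radius (pmom (punctured_polygons_sum C r s) k) \<ge> ereal xc"
    and "((\<lambda>x. eval_fps (pmom (punctured_polygons_sum C r s) k) x / eval_fps (fmom (k + r)) x)
      \<longlongrightarrow> fps_nth (perimeter_gf C ^ r) s / fact r * xc ^ s) (at_left xc)"
proof -
  define v where "v = Abs_fps (\<lambda>m. real (punctured_moment (punctured_polygons_sum C r s) k (m + s)))"
  let ?W = "fps_nth (perimeter_gf C ^ r) s"
  have j: "k + r \<ge> 1" using r by simp
  \<comment> \<open>Factoring out x^s leaves a series whose coefficients compare index by index with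
    the unpunctured one; at the critical point this factor becomes xc^s.\<close>
  have eq: "pmom (punctured_polygons_sum C r s) k = fps_X ^ s * v"
    by (rule fps_ext) (simp add: v_def fps_X_power_mult_nth punctured_moment_sum_eq_0)
  have "fps_conv_radius v \<ge> fps_conv_radius (mom (k + r))"
  proof (rule fps_conv_radius_ge_of_bound[OF always_eventually], rule allI)
    show "\<bar>fps_nth v m\<bar> \<le> ?W / fact r * fps_nth (mom (k + r)) m" for m
      using punctured_moment_sum_le[OF C, of r s k m] by (simp add: v_def field_simps)
  qed
  then have rv: "fps_conv_radius v \<ge> ereal xc" using radius_mom[OF j] by (rule order_trans[rotated])
  show "fps_conv_radius (pmom (punctured_polygons_sum C r s) k) \<ge> ereal xc"
    unfolding eq using fps_conv_radius_mult[of "fps_X ^ s" v] rv by (simp add: min_def split: if_splits)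
  have "((\<lambda>x. eval_fps v x / eval_fps (fmom (k + r)) x) \<longlongrightarrow> ?W / fact r) (at_left xc)"
    by (rule eval_fps_ratio_tendsto[OF xc])
      (use radius_fmom[of "k + r"] rv fmom_pos[OF j] fmom_at_top[OF j] punctured_shift_ratio[OF r, of s k] in
        \<open>simp_all add: v_def\<close>)
  then have "((\<lambda>x. x ^ s * (eval_fps v x / eval_fps (fmom (k + r)) x)) \<longlongrightarrow> xc ^ s * (?W / fact r)) (at_left xc)"
    by (intro tendsto_mult tendsto_power tendsto_ident_at)
  moreover have "eventually (\<lambda>x. x ^ s * (eval_fps v x / eval_fps (fmom (k + r)) x) =
      eval_fps (pmom (punctured_polygons_sum C r s) k) x / eval_fps (fmom (k + r)) x) (at_left xc)"
    using eventually_at_left_pos[OF xc]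
  proof eventually_elim
    case (elim x)
    then show ?case unfolding eq
      using eval_fps_mult[of x "fps_X ^ s" v] fps_conv_radius_gtD[OF rv elim] by simp
  qed
  ultimately have "((\<lambda>x. eval_fps (pmom (punctured_polygons_sum C r s) k) x / eval_fps (fmom (k + r)) x)
      \<longlongrightarrow> xc ^ s * (?W / fact r)) (at_left xc)"
    by (rule Lim_transform_eventually)
  then show "((\<lambda>x. eval_fps (pmom (punctured_polygons_sum C r s) k) x / eval_fps (fmom (k + r)) x)
      \<longlongrightarrow> ?W / fact r * xc ^ s) (at_left xc)"
    by (simp add: mult.commute)
qed

lemma shifted_exponent: "\<gamma> (k + r) = (real k - (\<theta> - real r)) / \<phi>"
  by (simp add: \<gamma>)

lemma amplitude_seriesI:
  assumes "has_area_amplitude_series Q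
      (\<lambda>k. (-1) ^ r * c * (falling_factorial (real (k + r)) r * f (k + r))) (\<lambda>k. \<gamma> (k + r))"
    and d: "d = (-1) ^ r * c"
  shows "\<exists>fr \<gamma>r. (\<forall>k. \<gamma>r k = (real k - (\<theta> - real r)) / \<phi>) \<and>
    has_area_amplitude_series Q fr \<gamma>r \<and>
    formal_series UNIV fr \<gamma>r = (\<lambda>b. d * formal_series {r..} (\<lambda>k. falling_factorial (real k) r * f k) \<gamma> b)"
  unfolding d formal_series_shift[symmetric]
  by (rule exI, rule exI, intro conjI allI, rule shifted_exponent, rule assms(1), rule refl)

lemma punctured_sum_amplitude_series:
  assumes r: "r \<ge> 1" and W: "fps_nth (perimeter_gf C ^ r) s \<noteq> 0"
  shows "\<exists>fr \<gamma>r. (\<forall>k. \<gamma>r k = (real k - (\<theta> - real r)) / \<phi>) \<and>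
     has_area_amplitude_series (generating_function (num_punctured (punctured_polygons_sum C r s))) fr \<gamma>r \<and>
     formal_series UNIV fr \<gamma>r =
       (\<lambda>b. (-1) ^ r / fact r * xc ^ s * fps_nth (perimeter_gf C ^ r) s *
          formal_series {r..} (\<lambda>k. falling_factorial (real k) r * f k) \<gamma> b)"
proof -
  define c where "c = fps_nth (perimeter_gf C ^ r) s / fact r * xc ^ s"
  have "0 < fps_nth (perimeter_gf C ^ r) s"
    by (rule le_neq_trans[OF perimeter_power_nonneg W[symmetric]])
  then have c: "c > 0" unfolding c_def using xc by (intro mult_pos_pos divide_pos_pos) simp_all
  have "has_area_amplitude_series (generating_function (num_punctured (punctured_polygons_sum C r s)))
      (\<lambda>k. (-1) ^ r * c * (falling_factorial (real (k + r)) r * f (k + r))) (\<lambda>k. \<gamma> (k + r))"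
    by (rule has_area_amplitude_seriesI[where Q = "\<lambda>t. t = s", OF r punctured_polygons_sum_def[of C r s]
        punctured_sum_ratio(1)[OF r, where s = s] c punctured_sum_ratio(2)[OF r, where s = s, folded c_def]])
  then show ?thesis by (rule amplitude_seriesI) (simp add: c_def)
qed

section \<open>Punctures of arbitrary size\<close>

lemma perimeter_gf_tendsto:
  assumes "\<theta> > 0"
  obtains Pc where "(eval_fps (perimeter_gf C) \<longlongrightarrow> Pc) (at_left xc)" "Pc > 0"
proof -
  define g where "g = factorial_moment_gf (generating_function (num_polygons C)) 0"
  have g: "g = perimeter_gf C"
    by (simp add: g_def factorial_moment_gf_def eval_q1_polygons)
  \<comment> \<open>The amplitude term of order 0 now vanishes at \<open>xc\<close>, so the
    asymptotic relation says that P(x) tends to its critical value.\<close>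
  have "\<gamma> 0 < 0" using assms \<phi> by (simp add: \<gamma> divide_neg_pos)
  then have "((\<lambda>x. (xc - x) powr (- \<gamma> 0)) \<longlongrightarrow> 0) (at_left xc)" by real_asymp
  then have "((\<lambda>x. f 0 * (xc - x) powr (- \<gamma> 0)) \<longlongrightarrow> f 0 * 0) (at_left xc)"
    by (intro tendsto_mult tendsto_const)
  then have "((\<lambda>x. eval_fps g x - critical_value g xc) \<longlongrightarrow> 0) (at_left xc)"
    using series_at_xc(2)[of 0] unfolding g_def by (simp add: asymp_equiv_tendsto_transfer asymp_equiv_sym)
  then have lim: "(eval_fps (perimeter_gf C) \<longlongrightarrow> critical_value g xc) (at_left xc)"
    unfolding g by (simp add: LIM_zero_iff)
  obtain m where m: "area_moment C 0 m > 0"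
    using area_moment_pos[of 0] by (auto simp: eventually_sequentially)
  \<comment> \<open>Positivity of the limit: the coefficients are nonnegative, so a single positive
    term bounds P(x) from below.\<close>
  have "area_moment C 0 m * xc ^ m \<le> critical_value g xc"
  proof (rule tendsto_le[OF _ lim])
    show "((\<lambda>x. area_moment C 0 m * x ^ m) \<longlongrightarrow> area_moment C 0 m * xc ^ m) (at_left xc)"
      by (intro tendsto_intros)
    show "eventually (\<lambda>x. area_moment C 0 m * x ^ m \<le> eval_fps (perimeter_gf C) x) (at_left xc)"
      using eventually_at_left_pos[OF xc]
    proof eventually_elim
      case (elim x)
      have "(\<Sum>i\<in>{m}. fps_nth (perimeter_gf C) i * x ^ i) \<le> eval_fps (perimeter_gf C) x"
        unfolding eval_fps_def
      proof (rule sum_le_suminf)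
        show "summable (\<lambda>i. fps_nth (perimeter_gf C) i * x ^ i)"
          by (rule summable_fps[OF fps_conv_radius_gtD[OF _ elim]]) (simp add: radius_perimeter)
      qed (use elim in \<open>auto simp: fps_nth_perimeter_gf[OF C]\<close>)
      then show ?case by (simp add: perimeter_gf_eq_mom)
    qed
  qed simp
  moreover have "area_moment C 0 m * xc ^ m > 0" using m xc by simp
  ultimately show ?thesis using that[OF lim] by linarith
qed

text \<open>The upper bound for each s is a term of a convolution, so summing over s gives a
  coefficient of a product of two series.\<close>

lemma punctured_moment_le:
  "real (punctured_moment (punctured_polygons C r) k m) \<le>
     fps_nth (fps_const (1 / fact r) * (perimeter_gf C ^ r * mom (k + r))) m"
proof -
  have "real (punctured_moment (punctured_polygons C r) k m) =
      (\<Sum>s\<le>m. real (punctured_moment (punctured_polygons_sum C r s) k m))"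
    by (simp add: punctured_moment_total[OF C order_refl])
  also have "\<dots> \<le> (\<Sum>s\<le>m. fps_nth (perimeter_gf C ^ r) s * area_moment C (k + r) (m - s) / fact r)"
  proof (rule sum_mono)
    fix s assume "s \<in> {..m}"
    then show "real (punctured_moment (punctured_polygons_sum C r s) k m) \<le>
        fps_nth (perimeter_gf C ^ r) s * area_moment C (k + r) (m - s) / fact r"
      using punctured_moment_sum_le[OF C, of r s k "m - s"] by (simp add: field_simps)
  qed
  finally show ?thesis
    unfolding fps_mult_left_const_nth by (simp add: fps_mult_nth sum_divide_distrib atMost_atLeast0)
qed

lemma punctured_moment_ge:
  "(\<Sum>s\<le>S. real (punctured_moment (punctured_polygons_sum C r s) k m)) \<le>
     real (punctured_moment (punctured_polygons C r) k m)"
proof -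
  have "(\<Sum>s\<le>S. real (punctured_moment (punctured_polygons_sum C r s) k m)) \<le>
      (\<Sum>s\<le>max S m. real (punctured_moment (punctured_polygons_sum C r s) k m))"
    by (intro sum_mono2) auto
  also have "\<dots> = real (punctured_moment (punctured_polygons C r) k m)"
    by (simp add: punctured_moment_total[OF C, of m "max S m"])
  finally show ?thesis .
qed

lemma radius_perimeter_power: "fps_conv_radius (perimeter_gf C ^ r) \<ge> ereal xc"
  using fps_conv_radius_power[of "perimeter_gf C" r] radius_perimeter by simp

lemma radius_punctured:
  assumes r: "r \<ge> 1"
  shows "fps_conv_radius (pmom (punctured_polygons C r) k) \<ge> ereal xc"
proof -
  have j: "k + r \<ge> 1" using r by simp
  have "ereal xc \<le> fps_conv_radius (perimeter_gf C ^ r * mom (k + r))"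
    by (rule order_trans[OF _ fps_conv_radius_mult]) (simp add: radius_perimeter_power radius_mom[OF j])
  also have "\<dots> = fps_conv_radius (fps_const (1 / fact r) * (perimeter_gf C ^ r * mom (k + r)))"
    by (simp add: fps_conv_radius_cmult_left)
  also have "\<dots> \<le> fps_conv_radius (pmom (punctured_polygons C r) k)"
    by (rule fps_conv_radius_ge_of_bound[of _ 1]) (use punctured_moment_le in simp)
  finally show ?thesis .
qed

text \<open>
  The upper bound is coefficientwise; the lower bound keeps only the punctures with total
  half-perimeter at most \<open>S\<close>, to which the result for fixed puncture sizes applies.
\<close>

lemma punctured_ratio:
  assumes r: "r \<ge> 1" and Pc: "(eval_fps (perimeter_gf C) \<longlongrightarrow> Pc) (at_left xc)"
  shows "((\<lambda>x. eval_fps (pmom (punctured_polygons C r) k) x / eval_fps (fmom (k + r)) x)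
      \<longlongrightarrow> Pc ^ r / fact r) (at_left xc)"
proof (rule order_tendstoI)
  have j: "k + r \<ge> 1" using r by simp
  let ?V = "eval_fps (pmom (punctured_polygons C r) k)"
  let ?U = "eval_fps (fmom (k + r))"
  have U_pos: "eventually (\<lambda>x. ?U x > 0) (at_left xc)"
    using fmom_at_top[OF j] by (simp add: filterlim_at_top_dense)
  have power_lim: "((\<lambda>x. eval_fps (perimeter_gf C ^ r) x) \<longlongrightarrow> Pc ^ r) (at_left xc)"
  proof (rule Lim_transform_eventually[OF tendsto_power[OF Pc]])
    show "eventually (\<lambda>x. eval_fps (perimeter_gf C) x ^ r = eval_fps (perimeter_gf C ^ r) x) (at_left xc)"
      using eventually_at_left_pos[OF xc] by eventually_elim (simp add: eval_fps_power radius_perimeter)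
  qed
  {
    fix a assume a: "a > Pc ^ r / fact r"
    have fm: "(\<lambda>m. fps_nth (mom (k + r)) m / fps_nth (fmom (k + r)) m) \<longlonglongrightarrow> 1"
      using tendsto_inverse[OF fmom_ratio[OF j]] by simp
    have "((\<lambda>x. eval_fps (mom (k + r)) x / ?U x) \<longlongrightarrow> 1) (at_left xc)"
      by (rule eval_fps_ratio_tendsto[OF xc _ radius_mom[OF j] _ _ fm fmom_at_top[OF j]])
        (use radius_fmom[of "k + r"] fmom_pos[OF j] in simp_all)
    then have "((\<lambda>x. 1 / fact r * (eval_fps (perimeter_gf C ^ r) x * (eval_fps (mom (k + r)) x / ?U x)))
        \<longlongrightarrow> 1 / fact r * (Pc ^ r * 1)) (at_left xc)"
      by (intro tendsto_mult tendsto_const power_lim)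
    then have "eventually (\<lambda>x. 1 / fact r * (eval_fps (perimeter_gf C ^ r) x * (eval_fps (mom (k + r)) x / ?U x)) < a) (at_left xc)"
      by (rule order_tendstoD(2)) (use a in simp)
    with U_pos eventually_at_left_pos[OF xc]
    show "eventually (\<lambda>x. ?V x / ?U x < a) (at_left xc)"
    proof eventually_elim
      case (elim x)
      have rad: "fps_conv_radius (perimeter_gf C ^ r * mom (k + r)) \<ge> ereal xc"
        by (rule order_trans[OF _ fps_conv_radius_mult]) (simp add: radius_perimeter_power radius_mom[OF j])
      have "?V x \<le> eval_fps (fps_const (1 / fact r) * (perimeter_gf C ^ r * mom (k + r))) x"
        by (rule eval_fps_mono[OF radius_punctured[OF r] _ elim(2)])
          (use rad punctured_moment_le in \<open>simp_all add: fps_conv_radius_cmult_left\<close>)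
      also have "\<dots> = 1 / fact r * (eval_fps (perimeter_gf C ^ r) x * eval_fps (mom (k + r)) x)"
        using fps_conv_radius_gtD[OF rad elim(2)] fps_conv_radius_gtD[OF radius_perimeter_power elim(2)]
          fps_conv_radius_gtD[OF radius_mom[OF j] elim(2)]
        by (simp only: eval_fps_cmult eval_fps_mult)
      finally have "?V x / ?U x \<le> 1 / fact r * (eval_fps (perimeter_gf C ^ r) x * eval_fps (mom (k + r)) x) / ?U x"
        using elim(1) by (intro divide_right_mono) auto
      then show ?case using elim(3) by simp
    qed
  next
    fix a assume a: "a < Pc ^ r / fact r"
    \<comment> \<open>S is found at a point y strictly below \<open>xc\<close>, where the partial
      sums converge; by nonnegativity the chosen partial sum only grows when y is replaced by
      \<open>xc\<close>.\<close>
    have "eventually (\<lambda>x. eval_fps (perimeter_gf C ^ r) x > fact r * a) (at_left xc)"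
      by (rule order_tendstoD(1)[OF power_lim]) (use a in \<open>simp add: field_simps\<close>)
    with eventually_at_left_pos[OF xc]
    have "eventually (\<lambda>x. (0 < x \<and> x < xc) \<and> eval_fps (perimeter_gf C ^ r) x > fact r * a) (at_left xc)"
      by (rule eventually_conj)
    then obtain y where y: "0 < y \<and> y < xc" "eval_fps (perimeter_gf C ^ r) y > fact r * a"
      using eventually_happens[of _ "at_left xc"] by auto
    have "(\<lambda>n. fps_nth (perimeter_gf C ^ r) n * y ^ n) sums eval_fps (perimeter_gf C ^ r) y"
      by (rule sums_eval_fps[OF fps_conv_radius_gtD[OF radius_perimeter_power y(1)]])
    then have "(\<lambda>S. \<Sum>s\<le>S. fps_nth (perimeter_gf C ^ r) s * y ^ s) \<longlonglongrightarrow> eval_fps (perimeter_gf C ^ r) y"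
      by (simp add: sums_def_le)
    from order_tendstoD(1)[OF this y(2)]
    obtain S where "(\<Sum>s\<le>S. fps_nth (perimeter_gf C ^ r) s * y ^ s) > fact r * a"
      by (auto simp: eventually_sequentially)
    moreover have "(\<Sum>s\<le>S. fps_nth (perimeter_gf C ^ r) s * y ^ s) \<le> (\<Sum>s\<le>S. fps_nth (perimeter_gf C ^ r) s * xc ^ s)"
      using y(1) perimeter_power_nonneg by (intro sum_mono mult_left_mono power_mono) auto
    ultimately have "fact r * a < (\<Sum>s\<le>S. fps_nth (perimeter_gf C ^ r) s * xc ^ s)" by linarith
    then have S: "a < (\<Sum>s\<le>S. fps_nth (perimeter_gf C ^ r) s / fact r * xc ^ s)"
      by (simp add: field_simps flip: sum_divide_distrib)
    have "((\<lambda>x. \<Sum>s\<le>S. eval_fps (pmom (punctured_polygons_sum C r s) k) x / ?U x)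
        \<longlongrightarrow> (\<Sum>s\<le>S. fps_nth (perimeter_gf C ^ r) s / fact r * xc ^ s)) (at_left xc)"
      by (intro tendsto_sum punctured_sum_ratio(2)[OF r])
    from order_tendstoD(1)[OF this S] U_pos eventually_at_left_pos[OF xc]
    show "eventually (\<lambda>x. ?V x / ?U x > a) (at_left xc)"
    proof eventually_elim
      case (elim x)
      have "(\<Sum>s\<le>S. eval_fps (pmom (punctured_polygons_sum C r s) k) x) =
          (\<Sum>n. \<Sum>s\<le>S. real (punctured_moment (punctured_polygons_sum C r s) k n) * x ^ n)"
        unfolding eval_fps_def
        using summable_fps[OF fps_conv_radius_gtD[OF punctured_sum_ratio(1)[OF r] elim(3)]]
        by (subst suminf_sum) auto
      also have "\<dots> \<le> ?V x"
        unfolding eval_fps_def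
      proof (rule suminf_le)
        fix n
        have "(\<Sum>s\<le>S. real (punctured_moment (punctured_polygons_sum C r s) k n)) * x ^ n \<le>
            real (punctured_moment (punctured_polygons C r) k n) * x ^ n"
          using elim(3) by (intro mult_right_mono punctured_moment_ge) auto
        then show "(\<Sum>s\<le>S. real (punctured_moment (punctured_polygons_sum C r s) k n) * x ^ n) \<le>
            fps_nth (pmom (punctured_polygons C r) k) n * x ^ n"
          by (simp add: sum_distrib_right)
      next
        show "summable (\<lambda>n. \<Sum>s\<le>S. real (punctured_moment (punctured_polygons_sum C r s) k n) * x ^ n)"
          using summable_fps[OF fps_conv_radius_gtD[OF punctured_sum_ratio(1)[OF r] elim(3)]]
          by (intro summable_sum) simp
        show "summable (\<lambda>n. fps_nth (pmom (punctured_polygons C r) k) n * x ^ n)"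
          by (rule summable_fps[OF fps_conv_radius_gtD[OF radius_punctured[OF r] elim(3)]])
      qed
      finally have "(\<Sum>s\<le>S. eval_fps (pmom (punctured_polygons_sum C r s) k) x) / ?U x \<le> ?V x / ?U x"
        using elim(2) by (intro divide_right_mono) auto
      then show ?case using elim(1) by (simp add: sum_divide_distrib)
    qed
  }
qed

lemma punctured_amplitude_series:
  assumes "\<theta> > 0"
  shows "\<exists>Pc. (eval_fps (perimeter_gf C) \<longlongrightarrow> Pc) (at_left xc) \<and>
    (\<forall>r \<ge> 1. \<exists>fr \<gamma>r. (\<forall>k. \<gamma>r k = (real k - (\<theta> - real r)) / \<phi>) \<and>
       has_area_amplitude_series (generating_function (num_punctured (punctured_polygons C r))) fr \<gamma>r \<and>
       formal_series UNIV fr \<gamma>r =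
         (\<lambda>b. (-1) ^ r / fact r * Pc ^ r *
            formal_series {r..} (\<lambda>k. falling_factorial (real k) r * f k) \<gamma> b))"
proof -
  obtain Pc where Pc: "(eval_fps (perimeter_gf C) \<longlongrightarrow> Pc) (at_left xc)" "Pc > 0"
    by (rule perimeter_gf_tendsto[OF assms])
  have "\<exists>fr \<gamma>r. (\<forall>k. \<gamma>r k = (real k - (\<theta> - real r)) / \<phi>) \<and>
       has_area_amplitude_series (generating_function (num_punctured (punctured_polygons C r))) fr \<gamma>r \<and>
       formal_series UNIV fr \<gamma>r =
         (\<lambda>b. (-1) ^ r / fact r * Pc ^ r *
            formal_series {r..} (\<lambda>k. falling_factorial (real k) r * f k) \<gamma> b)" if r: "r \<ge> 1" for r
  proof -
    define c where "c = Pc ^ r / fact r"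
    have c: "c > 0" using Pc(2) by (simp add: c_def)
    have "has_area_amplitude_series (generating_function (num_punctured (punctured_polygons C r)))
        (\<lambda>k. (-1) ^ r * c * (falling_factorial (real (k + r)) r * f (k + r))) (\<lambda>k. \<gamma> (k + r))"
      by (rule has_area_amplitude_seriesI[where Q = "\<lambda>_. True", OF r _ radius_punctured[OF r] c
          punctured_ratio[OF r Pc(1), folded c_def]]) simp
    then show ?thesis by (rule amplitude_seriesI) (simp add: c_def)
  qed
  then show ?thesis using Pc(1) by blast
qed

end

theorem theorem4:
  fixes C :: "polygon set"
    and A \<gamma> f :: "nat \<Rightarrow> real"
    and xc \<theta> \<phi> :: real
  assumes "polygon_class C"
    and "xc > 0" and "0 < \<phi>" and "\<phi> < 1"
    and "\<And>k. A k > 0"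
    and "\<And>k. \<gamma> k = (real k - \<theta>) / \<phi>"
    and "\<And>k. \<gamma> k > -1 \<and> \<gamma> k \<noteq> 0"
    and "\<And>k. (\<lambda>m. area_moment C k m)
               \<sim>[sequentially] (\<lambda>m. A k * xc powr (- real m) * real m powr (\<gamma> k - 1))"
    and "\<And>k. f k = (-1) ^ k / fact k * A k * xc powr \<gamma> k * Gamma (\<gamma> k) \<and> f k \<noteq> 0"
    and "has_area_amplitude_series (generating_function (num_polygons C)) f \<gamma>"
  shows
    "(\<forall>r s. r \<ge> 1 \<and> fps_nth (perimeter_gf C ^ r) s \<noteq> 0 \<longrightarrow>
        (\<exists>fr \<gamma>r.
           (\<forall>k. \<gamma>r k = (real k - (\<theta> - real r)) / \<phi>) \<and>
           has_area_amplitude_series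
             (generating_function (num_punctured (punctured_polygons_sum C r s))) fr \<gamma>r \<and>
           formal_series UNIV fr \<gamma>r =
             (\<lambda>b. (-1) ^ r / fact r * xc ^ s * fps_nth (perimeter_gf C ^ r) s *
                  formal_series {r..} (\<lambda>k. falling_factorial (real k) r * f k) \<gamma> b)))
     \<and> (\<theta> > 0 \<longrightarrow>
        (\<exists>Pc. (eval_fps (perimeter_gf C) \<longlongrightarrow> Pc) (at_left xc) \<and>
          (\<forall>r \<ge> 1. \<exists>fr \<gamma>r.
             (\<forall>k. \<gamma>r k = (real k - (\<theta> - real r)) / \<phi>) \<and>
             has_area_amplitude_series
               (generating_function (num_punctured (punctured_polygons C r))) fr \<gamma>r \<and>
             formal_series UNIV fr \<gamma>r =
               (\<lambda>b. (-1) ^ r / fact r * Pc ^ r *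
                    formal_series {r..} (\<lambda>k. falling_factorial (real k) r * f k) \<gamma> b))))"
proof -
  interpret polygon_model C A \<gamma> f xc \<theta> \<phi>
    using assms by unfold_locales auto
  show ?thesis
    using punctured_sum_amplitude_series punctured_amplitude_series by blast
qed

end
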